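(* Let $q\in\mathbb{N}^+$ and let $G=(V,E)$ be a finite $(q+1)$-regular graph with normalized spectral measure $\mu_G$. Then for every $p\in\mathbb{C}$, $$\hat\mu_G(p)=\hat\mu_q(p)+\sum_{r=1}^{\infty}q^{-r/2}\,i^r J_r(2p)\,\frac{c_r(G)}{|V|},$$ and the series converges absolutely and uniformly on every compact subset of $\mathbb{C}$ (in $p$).
   Context: Graphs are undirected, possibly with multiple edges and loops; each edge gives two mutually inverse directed edges; $(q+1)$-regular means every vertex is the origin of $q+1$ directed edges, and $A_{ab}$ is the number of directed edges from $a$ to $b$. If $\lambda_1(A),\dots,\lambda_{|V|}(A)$ are the eigenvalues of $A$, $\mu_G=\frac{1}{|V|}\sum_k\delta_{q^{-1/2}\lambda_k(A)}$. A circuit of length $n\ge1$ is a closed walk of directed edges $e_0,\dots,e_{n-1}$ ($t(e_i)=o(e_{i+1})$, $t(e_{n-1})=o(e_0)$) with $e_{i+1}\ne\bar e_i$ for all $i$ and $e_0\ne\bar e_{n-1}$; $c_r(G)$ counts circuits of length $r$ (as sequences). For a probability measure $\mu$ on $\mathbb{R}$ with compact support, $\hat\mu(p)=\int e^{ipx}d\mu(x)$. $\mu_q$ is the Kesten–McKay distribution: $d\mu_1(x)=\frac{1}{\pi\sqrt{4-x^2}}\mathbf{1}_{|x|\le2}dx$ and for $q>1$, $d\mu_q(x)=\frac{1}{2\pi}\frac{(q+1)\sqrt{4-x^2}}{(q^{1/2}+q^{-1/2})^2-x^2}\mathbf{1}_{|x|\le 2}dx$. $J_r$ is the Bessel function of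 the first kind of order $r$. *)

theory Defs
  imports
    "HOL-Probability.Probability"
    "Graph_Theory.Bidirected_Digraph"
    "Jordan_Normal_Form.Char_Poly"
begin

text \<open>
  An undirected graph, possibly with loops and multiple edges, is given by its directed edges
  together with the inversion \<open>arev\<close>: the locale \<^locale>\<open>bidirected_digraph\<close> makes \<open>arev\<close> an
  involution without fixed points on the arcs that exchanges tail and head.  In particular a loop
  contributes two distinct, mutually inverse arcs at its vertex.
\<close>

definition regular_digraph :: "nat \<Rightarrow> ('a, 'b) pre_digraph \<Rightarrow> bool" where
  "regular_digraph d G \<longleftrightarrow> (\<forall>v \<in> verts G. out_degree G v = d)"

text \<open>
  For finite \<open>verts G\<close>, \<^const>\<open>from_nat_into\<close> \<open>(verts G)\<close> is a bijection from
  \<open>{..<card (verts G)}\<close> onto \<open>verts G\<close>; the spectrum does not depend on this numbering.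
\<close>

definition adj_matrix :: "('a, 'b) pre_digraph \<Rightarrow> real mat" where
  "adj_matrix G =
     Matrix.mat (card (verts G)) (card (verts G))
       (\<lambda>(i, j). real (card {e \<in> arcs G. tail G e = from_nat_into (verts G) i \<and>
                                         head G e = from_nat_into (verts G) j}))"

text \<open>Eigenvalues, repeated according to their multiplicity.\<close>

definition adj_eigenvalues :: "('a, 'b) pre_digraph \<Rightarrow> real multiset" where
  "adj_eigenvalues G = proots (char_poly (adj_matrix G))"

text \<open>
  The point mass at each eigenvalue is its multiplicity divided by \<open>|V|\<close>; the measure is then
  pushed forward under scaling by \<open>q\<^sup>-\<^sup>1\<^sup>/\<^sup>2\<close>.
\<close>

definition spectral_measure :: "nat \<Rightarrow> ('a, 'b) pre_digraph \<Rightarrow> real measure" where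
  "spectral_measure q G =
     distr
       (point_measure (set_mset (adj_eigenvalues G))
         (\<lambda>x. ennreal (real (count (adj_eigenvalues G) x) / real (card (verts G)))))
       borel (\<lambda>x. x / sqrt (real q))"

definition kesten_mckay_density :: "nat \<Rightarrow> real \<Rightarrow> real" where
  "kesten_mckay_density q x =
     (if q = 1 then 1 / (pi * sqrt (4 - x\<^sup>2))
      else 1 / (2 * pi) *
        ((real q + 1) * sqrt (4 - x\<^sup>2) / ((sqrt (real q) + 1 / sqrt (real q))\<^sup>2 - x\<^sup>2)))
     * indicator {-2..2} x"

definition kesten_mckay :: "nat \<Rightarrow> real measure" where
  "kesten_mckay q = density lborel (\<lambda>x. ennreal (kesten_mckay_density q x))"

definition fourier_transform :: "real measure \<Rightarrow> complex \<Rightarrow> complex" where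
  "fourier_transform M p = (LINT x|M. exp (\<i> * p * of_real x))"

definition is_circuit :: "('a, 'b) pre_digraph \<Rightarrow> ('b \<Rightarrow> 'b) \<Rightarrow> 'b list \<Rightarrow> bool" where
  "is_circuit G arev es \<longleftrightarrow>
     es \<noteq> [] \<and> set es \<subseteq> arcs G \<and>
     (\<forall>i. Suc i < length es \<longrightarrow>
        head G (es ! i) = tail G (es ! Suc i) \<and> es ! Suc i \<noteq> arev (es ! i)) \<and>
     head G (last es) = tail G (hd es) \<and> hd es \<noteq> arev (last es)"

definition circuit_count :: "('a, 'b) pre_digraph \<Rightarrow> ('b \<Rightarrow> 'b) \<Rightarrow> nat \<Rightarrow> nat" where
  "circuit_count G arev r = card {es. is_circuit G arev es \<and> length es = r}"

text \<open>Bessel function of the first kind of nonnegative integer order, by its power series.\<close>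

definition bessel_J :: "nat \<Rightarrow> complex \<Rightarrow> complex" where
  "bessel_J r z = (\<Sum>m. (-1) ^ m / (fact m * fact (m + r)) * (z / 2) ^ (2 * m + r))"

definition circuit_term ::
  "nat \<Rightarrow> ('a, 'b) pre_digraph \<Rightarrow> ('b \<Rightarrow> 'b) \<Rightarrow> nat \<Rightarrow> complex \<Rightarrow> complex" where
  "circuit_term q G arev r p =
     of_real (real q powr (- real r / 2)) * \<i> ^ r * bessel_J r (2 * p) *
     (of_nat (circuit_count G arev r) / of_nat (card (verts G)))"

end

(*
  For w + 1/w = x, grouping the product of the exponential series of i p w and i p / w by the
  exponent of w gives exp (i p x) = J_0(2p) + sum_{r >= 1} i^r J_r(2p) (w^r + 1/w^r), and the last
  factor is a Dickson polynomial in x.  Integrating this against the spectral measure and against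
  the Kesten-McKay measure reduces the theorem to a comparison of Dickson moments.

  The r-th power of the non-backtracking matrix B on arcs has trace c_r(G).  With H and O the
  arc-vertex incidence matrices of heads and tails and J the arc reversal, B = H O^t - J, which
  yields B H = H A - O and B O = q H.  Hence the differences tr B^(r+2) - tr B^r are traces of
  polynomials in A, and c_r(G) is the sum of the Dickson polynomials D_r(lambda, q) over the
  eigenvalues plus (q - 1) |V| (1 + (-1)^r) / 2.  The correction term is cancelled by the moments
  of the Kesten-McKay measure, whose density in the angle is
  (1 - (q - 1) sum_{k >= 1} q^(-k) cos (2 k theta)) / pi.
*)
theory Submission
  imports Defs "Jordan_Normal_Form.Schur_Decomposition"
begin

section \<open>The Jacobi--Anger expansion\<close>

text \<open>The obstacle is the reversal J, which is not a polynomial in A: a power of B times J has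
  no evident trace. What saves the computation is that the product of J and B contains the identity
  matrix, so the unwanted term turns into a trace of B two powers lower. This is why differences at
  distance two are formed, and why the correction depends on the parity of r alone, being fixed by
  the powers 0 and 1. On the analytic side the growth in the order is governed by one estimate,
  |J_r(2p)| \<le> |p|^r exp(|p|^2) / r!. The factorial outweighs anything of exponential growth in
  r, including the number of circuits, so the same bound serves the interchange of the expansion
  with the angle integral and the uniform convergence on compact sets.\<close>

fun dickson :: "'a::comm_ring_1 \<Rightarrow> nat \<Rightarrow> 'a \<Rightarrow> 'a" where
  "dickson a 0 x = 2"
| "dickson a (Suc 0) x = x"
| "dickson a (Suc (Suc r)) x = x * dickson a (Suc r) x - a * dickson a r x"

text \<open>\<open>u\<close> and \<open>v\<close> are the roots of t^2 - (u + v) t + a, so their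
  powers obey the Dickson recursion; the initial value 2 is u^0 + v^0.\<close>

lemma dickson_add:
  fixes u v :: "'a::comm_ring_1"
  assumes "u * v = a"
  shows "dickson a r (u + v) = u ^ r + v ^ r"
  unfolding assms[symmetric]
proof (induction "u * v" r "u + v" rule: dickson.induct)
  case (3 r)
  show ?case
    unfolding dickson.simps 3 by (simp add: algebra_simps)
qed auto

text \<open>The recursion is homogeneous if \<open>x\<close> has weight one and \<open>a\<close>
  weight two. With c = sqrt q this passes from the parameter q of the trace formula to the parameter
  1 of the Jacobi-Anger expansion.\<close>

lemma dickson_scale:
  fixes x :: "'a::comm_ring_1"
  shows "dickson (c ^ 2 * a) r (c * x) = c ^ r * dickson a r x"
proof (induction a r x rule: dickson.induct)
  case (3 a r x)
  show ?case unfolding dickson.simps 3 by (simp add: algebra_simps power2_eq_square)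
qed simp_all

lemma of_real_dickson:
  "of_real (dickson a r x) = (dickson (of_real a) r (of_real x) :: 'a::{real_algebra_1,comm_ring_1})"
  by (induction a r x rule: dickson.induct) simp_all

section \<open>Power series of the Bessel functions: absolute convergence and growth in the
  order\<close>

definition bessel_coeff :: "nat \<Rightarrow> complex \<Rightarrow> nat \<Rightarrow> complex" where
  "bessel_coeff r z m = (-1) ^ m / (fact m * fact (m + r)) * (z / 2) ^ (2 * m + r)"

text \<open>Replacing (m + r)! by r! separates the indices: the sum over \<open>m\<close> becomes an
  exponential, and 1/r! is kept to control the sum over orders.\<close>

lemma norm_bessel_coeff_le:
  "norm (bessel_coeff r z m) \<le> norm (z / 2) ^ r / fact r * ((norm (z / 2))\<^sup>2 ^ m / fact m)"
proof -
  have "norm (bessel_coeff r z m) = norm (z/2) ^ (2 * m + r) / (fact m * fact (m + r))"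
    by (simp add: bessel_coeff_def norm_mult norm_divide norm_power)
  also have "\<dots> \<le> norm (z/2) ^ (2 * m + r) / (fact m * fact r)"
    by (intro divide_left_mono mult_left_mono fact_mono) auto
  also have "\<dots> = norm (z / 2) ^ r / fact r * ((norm (z / 2))\<^sup>2 ^ m / fact m)"
    unfolding power_add power_mult by (simp only: times_divide_times_eq mult.commute)
  finally show ?thesis .
qed

lemma summable_exp_real: "summable (\<lambda>m. (x::real) ^ m / fact m)" "(\<Sum>m. (x::real) ^ m / fact m) = exp x"
  using exp_converges[of x] by (auto simp: sums_iff field_simps)

lemma summable_norm_bessel_coeff: "summable (\<lambda>m. norm (bessel_coeff r z m))"
proof (rule summable_comparison_test')
  show "summable (\<lambda>m. norm (z / 2) ^ r / fact r * ((norm (z / 2))\<^sup>2 ^ m / fact m))"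
    by (intro summable_mult summable_exp_real)
  show "norm (norm (bessel_coeff r z m)) \<le> norm (z / 2) ^ r / fact r * ((norm (z / 2))\<^sup>2 ^ m / fact m)"
    if "m \<ge> 0" for m
    using norm_bessel_coeff_le[of r z m] by simp
qed

lemma bessel_J_sums: "bessel_coeff r z sums bessel_J r z"
  using summable_norm_cancel[OF summable_norm_bessel_coeff[of r z]]
  by (simp add: sums_iff bessel_J_def bessel_coeff_def[abs_def])

lemma norm_bessel_J_le:
  "norm (bessel_J r z) \<le> norm (z / 2) ^ r / fact r * exp ((norm (z / 2))\<^sup>2)"
proof -
  have "norm (bessel_J r z) \<le> (\<Sum>m. norm (bessel_coeff r z m))"
    using summable_norm[OF summable_norm_bessel_coeff[of r z]] bessel_J_sums[of r z]
    by (simp add: sums_iff)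
  also have "\<dots> \<le> (\<Sum>m. norm (z / 2) ^ r / fact r * ((norm (z / 2))\<^sup>2 ^ m / fact m))"
    by (intro suminf_le norm_bessel_coeff_le summable_norm_bessel_coeff summable_mult summable_exp_real)
  also have "\<dots> = norm (z / 2) ^ r / fact r * exp ((norm (z / 2))\<^sup>2)"
    by (subst suminf_mult) (auto simp only: summable_exp_real)
  finally show ?thesis .
qed

lemma exp_has_sum: "((\<lambda>n. (z::complex) ^ n / fact n) has_sum exp z) UNIV"
proof (rule norm_summable_imp_has_sum)
  show "summable (\<lambda>n. norm (z ^ n / fact n))"
    using summable_exp_real(1)[of "norm z"] by (simp add: norm_divide norm_power)
  show "(\<lambda>n. z ^ n / fact n) sums exp z"
    using exp_converges[of z] by (simp add: scaleR_conv_of_real field_simps)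
qed

text \<open>An unordered sum over pairs, because the expansion below regroups it by the difference a
  - b; absolute summability is what allows this.\<close>

lemma exp_mult_exp_has_sum:
  fixes u v :: complex
  shows "((\<lambda>(a, b). (u ^ a / fact a) * (v ^ b / fact b)) has_sum (exp u * exp v)) (UNIV \<times> UNIV)"
proof -
  let ?F = "\<lambda>(a, b). (u ^ a / fact a) * (v ^ b / fact b) :: complex"
  have abs: "(\<lambda>n. norm ((z::complex) ^ n / fact n)) summable_on UNIV" for z
    using summable_exp_real(1)[of "norm z"]
    by (subst summable_on_UNIV_nonneg_real_iff) (auto simp: norm_divide norm_power)
  have "(\<lambda>x. norm (?F x)) summable_on (UNIV \<times> UNIV)"
    unfolding Infinite_Sum.abs_summable_on_Sigma_iff
  proof (intro conjI ballI)
    show "(\<lambda>y. norm (?F (a, y))) summable_on UNIV" for a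
      using summable_on_cmult_right[OF abs[of v], of "norm (u ^ a / fact a)"]
      by (simp only: norm_mult prod.case)
    have nonneg: "0 \<le> (\<Sum>\<^sub>\<infinity>y. norm (v ^ y / fact y))" by (rule infsum_nonneg) simp
    have "(\<lambda>a. norm (u ^ a / fact a) * (\<Sum>\<^sub>\<infinity>y. norm (v ^ y / fact y))) summable_on UNIV"
      by (rule summable_on_cmult_left[OF abs])
    then show "(\<lambda>a. norm (\<Sum>\<^sub>\<infinity>y. norm (?F (a, y)))) summable_on UNIV"
      by (simp only: norm_mult infsum_cmult_right' prod.case real_norm_def abs_mult abs_norm_cancel
                     abs_of_nonneg[OF nonneg])
  qed
  then have summ: "(?F has_sum infsum ?F (UNIV \<times> UNIV)) (UNIV \<times> UNIV)"
    by (rule has_sum_infsum[OF Infinite_Sum.abs_summable_summable])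
  have "((\<lambda>a. u ^ a / fact a * exp v) has_sum infsum ?F (UNIV \<times> UNIV)) UNIV"
    by (rule has_sum_SigmaD[OF summ]) (simp only: prod.case has_sum_cmult_right exp_has_sum)
  moreover have "((\<lambda>a. u ^ a / fact a * exp v) has_sum (exp u * exp v)) UNIV"
    by (intro has_sum_cmult_left exp_has_sum)
  ultimately have "infsum ?F (UNIV \<times> UNIV) = exp u * exp v"
    by (rule has_sum_unique)
  with summ show ?thesis by simp
qed

lemma Jacobi_Anger:
  fixes p x :: complex
  shows "(\<lambda>r. \<i> ^ Suc r * bessel_J (Suc r) (2 * p) * dickson 1 (Suc r) x)
           sums (exp (\<i> * p * x) - bessel_J 0 (2 * p))"
proof -
  obtain w where w: "w\<^sup>2 - x * w + 1 = 0"
  proof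
    show "((x + csqrt (x\<^sup>2 - 4)) / 2)\<^sup>2 - x * ((x + csqrt (x\<^sup>2 - 4)) / 2) + 1 = 0"
      using power2_csqrt[of "x\<^sup>2 - 4"] by (simp add: power2_sum power_divide) (simp add: power2_eq_square field_simps)
  qed
  have w0: "w \<noteq> 0" using w by auto
  then have x: "x = w + 1 / w" using w by (simp add: field_simps power2_eq_square)
  let ?F = "\<lambda>(a, b). ((\<i> * p * w) ^ a / fact a) * ((\<i> * p / w) ^ b / fact b)"
  \<comment> \<open>\<open>?h1\<close> lists the pairs in which \<open>w\<close> has exponent r
    \<ge> 0, \<open>?h2\<close> those with exponent - (r + 1); the shift on one side keeps the
    diagonal from occurring twice.\<close>
  let ?h1 = "\<lambda>(r, m). (m + r, m) :: nat \<times> nat" and ?h2 = "\<lambda>(r, m). (m, m + Suc r) :: nat \<times> nat"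
  have F: "(?F has_sum exp (\<i> * p * x)) UNIV"
    using exp_mult_exp_has_sum[of "\<i> * p * w" "\<i> * p / w"]
    by (simp add: x ring_distribs exp_add)
  have inj: "inj ?h1" "inj ?h2" by (auto simp: inj_on_def)
  have disj: "range ?h1 \<inter> range ?h2 = {}" by auto
  have "(a, b) \<in> range ?h1 \<union> range ?h2" for a b
  proof (cases "b \<le> a")
    case True
    then have "(a, b) = ?h1 (a - b, b)" by auto
    then show ?thesis by blast
  next
    case False
    then have "(a, b) = ?h2 (b - Suc a, a)" by auto
    then show ?thesis by blast
  qed
  then have un: "range ?h1 \<union> range ?h2 = UNIV" by auto
  have so: "?F summable_on A" for A
    using F summable_on_subset_banach[of ?F UNIV A] by (auto simp: summable_on_def)
  define S1 S2 where "S1 = infsum ?F (range ?h1)" and "S2 = infsum ?F (range ?h2)"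
  have S: "S1 + S2 = exp (\<i> * p * x)"
    using infsum_Un_disjoint[OF so so disj] infsumI[OF F] unfolding un S1_def S2_def by simp
  have ipow: "\<i> ^ (2 * m + r) = (-1) ^ m * \<i> ^ r" for m r
    by (simp add: power_add power_mult)
  have mono: "(u * w) ^ (m + r) * (u / w) ^ m = u ^ (2 * m + r) * w ^ r"
             "(u * w) ^ m * (u / w) ^ (m + r) = u ^ (2 * m + r) * (1 / w) ^ r" for u :: complex and m r
    using w0 by (simp_all add: power_mult_distrib power_divide power_add mult_2)
  have bc: "bessel_coeff r (2 * p) m = (-1) ^ m * p ^ (2 * m + r) / (fact m * fact (m + r))" for r m
    by (simp add: bessel_coeff_def)
  have F1: "?F (?h1 (r, m)) = \<i> ^ r * w ^ r * bessel_coeff r (2 * p) m" for r m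
  proof -
    have "?F (?h1 (r, m)) = (\<i> * p) ^ (2 * m + r) * w ^ r / (fact m * fact (m + r))"
      using mono(1)[of "\<i> * p" m r] by (simp add: mult.commute)
    also have "\<dots> = \<i> ^ (2 * m + r) * p ^ (2 * m + r) * w ^ r / (fact m * fact (m + r))"
      by (simp only: power_mult_distrib)
    finally show ?thesis
      unfolding ipow bc by (simp only: times_divide_eq_right times_divide_eq_left mult_ac)
  qed
  have F2: "?F (?h2 (r, m)) = \<i> ^ Suc r * (1 / w) ^ Suc r * bessel_coeff (Suc r) (2 * p) m" for r m
  proof -
    have "?F (?h2 (r, m)) = (\<i> * p) ^ (2 * m + Suc r) * (1 / w) ^ Suc r / (fact m * fact (m + Suc r))"
      using mono(2)[of "\<i> * p" m "Suc r"] by (simp del: add_Suc_right)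
    also have "\<dots> = \<i> ^ (2 * m + Suc r) * p ^ (2 * m + Suc r) * (1 / w) ^ Suc r / (fact m * fact (m + Suc r))"
      by (simp only: power_mult_distrib)
    finally show ?thesis
      unfolding ipow bc by (simp only: times_divide_eq_right times_divide_eq_left mult_ac)
  qed
  have J: "(bessel_coeff r z has_sum bessel_J r z) UNIV" for r z
    by (rule norm_summable_imp_has_sum[OF summable_norm_bessel_coeff bessel_J_sums])
  have "(?F \<circ> ?h1 has_sum S1) (UNIV \<times> UNIV)"
    using has_sum_infsum[OF so[of "range ?h1"]] inj(1) by (simp add: has_sum_reindex S1_def)
  then have "((\<lambda>r. \<i> ^ r * w ^ r * bessel_J r (2 * p)) has_sum S1) UNIV"
    by (rule has_sum_SigmaD) (simp only: comp_def F1 has_sum_cmult_right J)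
  then have "(\<lambda>r. \<i> ^ r * w ^ r * bessel_J r (2 * p)) sums S1"
    by (rule has_sum_imp_sums)
  then have 1: "(\<lambda>r. \<i> ^ Suc r * w ^ Suc r * bessel_J (Suc r) (2 * p)) sums (S1 - bessel_J 0 (2 * p))"
    by (subst sums_Suc_iff) simp
  have "(?F \<circ> ?h2 has_sum S2) (UNIV \<times> UNIV)"
    using has_sum_infsum[OF so[of "range ?h2"]] inj(2) by (simp add: has_sum_reindex S2_def)
  then have "((\<lambda>r. \<i> ^ Suc r * (1 / w) ^ Suc r * bessel_J (Suc r) (2 * p)) has_sum S2) UNIV"
    by (rule has_sum_SigmaD) (simp only: comp_def F2 has_sum_cmult_right J)
  then have 2: "(\<lambda>r. \<i> ^ Suc r * (1 / w) ^ Suc r * bessel_J (Suc r) (2 * p)) sums S2"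
    by (rule has_sum_imp_sums)
  have d: "dickson 1 r x = w ^ r + (1 / w) ^ r" for r
    unfolding x by (rule dickson_add) (use w0 in simp)
  show ?thesis
    using sums_add[OF 1 2] unfolding d S[symmetric]
    by (simp only: ring_distribs mult_ac add_ac diff_add_eq add_diff_eq)
qed

section \<open>The Fourier transform of the Kesten--McKay distribution\<close>

text \<open>
  The Kesten--McKay density in the angle \<open>\<theta>\<close> with \<open>x = - 2 cos \<theta>\<close>, expanded with the Poisson
  kernel.  For \<open>q = 1\<close> the series is meaningless but its factor vanishes.
\<close>

definition km_angle_density :: "nat \<Rightarrow> real \<Rightarrow> real" where
  "km_angle_density q \<theta> =
     (1 - (real q - 1) * (\<Sum>k. (1 / real q) ^ Suc k * cos (2 * real (Suc k) * \<theta>))) / pi"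

text \<open>Real part of the geometric series with ratio s e^(i \<phi>). At s = 1/q and \<phi> = 2
  \<theta> it evaluates the series in \<open>km_angle_density\<close>.\<close>

lemma sums_geometric_cos:
  fixes s \<phi> :: real
  assumes "\<bar>s\<bar> < 1"
  shows "(\<lambda>k. s ^ Suc k * cos (real (Suc k) * \<phi>)) sums ((s * cos \<phi> - s\<^sup>2) / (1 - 2 * s * cos \<phi> + s\<^sup>2))"
proof -
  define z where "z = of_real s * cis \<phi>"
  have nz: "norm z < 1" using assms by (simp add: z_def norm_mult)
  have "(\<lambda>k. z * z ^ k) sums (z * (1 / (1 - z)))"
    by (intro sums_mult geometric_sums nz)
  then have "(\<lambda>k. Re (z * z ^ k)) sums Re (z * (1 / (1 - z)))"
    by (rule sums_Re)
  moreover have "Re (z * z ^ k) = s ^ Suc k * cos (real (Suc k) * \<phi>)" for k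
  proof -
    have "z * z ^ k = of_real (s ^ Suc k) * cis (real (Suc k) * \<phi>)"
    proof -
      have "z * z ^ k = z ^ Suc k" by simp
      also have "\<dots> = of_real s ^ Suc k * cis \<phi> ^ Suc k" by (simp only: z_def power_mult_distrib)
      finally show ?thesis by (simp only: Complex.DeMoivre of_real_power)
    qed
    then show ?thesis by (simp only: times_complex.sel Re_complex_of_real Im_complex_of_real cis.sel)
  qed
  moreover have "Re (z * (1 / (1 - z))) = (s * cos \<phi> - s\<^sup>2) / (1 - 2 * s * cos \<phi> + s\<^sup>2)"
  proof -
    have sc: "(sin \<phi>)\<^sup>2 = 1 - (cos \<phi>)\<^sup>2" by (simp add: sin_squared_eq)
    have "(1 - s * cos \<phi>)\<^sup>2 + (s * sin \<phi>)\<^sup>2 = 1 - 2 * s * cos \<phi> + s\<^sup>2"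
      by (simp add: power_mult_distrib sc power2_diff) (simp add: algebra_simps)
    moreover have "s * cos \<phi> * (1 - s * cos \<phi>) - s * sin \<phi> * (s * sin \<phi>) = s * cos \<phi> - s\<^sup>2"
    proof -
      have "s * cos \<phi> * (1 - s * cos \<phi>) - s * sin \<phi> * (s * sin \<phi>) =
          s * cos \<phi> - s\<^sup>2 * ((sin \<phi>)\<^sup>2 + (cos \<phi>)\<^sup>2)"
        by (simp only: algebra_simps power2_eq_square)
      then show ?thesis by simp
    qed
    ultimately show ?thesis
      by (simp add: z_def Re_divide cmod_power2)
  qed
  ultimately show ?thesis by simp
qed

section \<open>Cosine moments of the angle density\<close>

lemma integral_cos_pi:
  fixes n :: int
  shows "has_bochner_integral lborel (\<lambda>\<theta>. cos (real_of_int n * \<theta>) * indicator {0..pi} \<theta>) (if n = 0 then pi else 0)"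
proof (cases "n = 0")
  case True
  then show ?thesis
    using has_bochner_integral_FTC_Icc_real[of 0 pi "\<lambda>x. x" "\<lambda>_. 1"] by (auto intro!: derivative_eq_intros)
next
  case False
  have "has_bochner_integral lborel (\<lambda>\<theta>. cos (real_of_int n * \<theta>) * indicator {0..pi} \<theta>)
     (sin (real_of_int n * pi) / n - sin (real_of_int n * 0) / n)"
    using False by (intro has_bochner_integral_FTC_Icc_real) (auto intro!: derivative_eq_intros)
  with False show ?thesis by (simp add: mult.commute[of _ pi] sin_npi_int)
qed

lemma integral_cos_cos:
  assumes "a > 0"
  shows "has_bochner_integral lborel (\<lambda>\<theta>. cos (real a * \<theta>) * cos (real r * \<theta>) * indicator {0..pi} \<theta>)
    (if a = r then pi / 2 else 0)"
proof -
  have "has_bochner_integral lborel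
    (\<lambda>\<theta>. (cos (real_of_int (int a - int r) * \<theta>) * indicator {0..pi} \<theta> +
          cos (real_of_int (int a + int r) * \<theta>) * indicator {0..pi} \<theta>) / 2)
    (((if int a - int r = 0 then pi else 0) + (if int a + int r = 0 then pi else 0)) / 2)"
    by (intro has_bochner_integral_divide_zero has_bochner_integral_add integral_cos_pi)
  moreover have "(cos (real_of_int (int a - int r) * \<theta>) * indicator {0..pi} \<theta> +
          cos (real_of_int (int a + int r) * \<theta>) * indicator {0..pi} \<theta>) / 2 =
     cos (real a * \<theta>) * cos (real r * \<theta>) * indicator {0..pi} \<theta>" for \<theta>
    by (simp add: cos_times_cos algebra_simps)
  ultimately show ?thesis using assms by (simp split: if_splits)
qed

text \<open>Orthogonality of the cosines leaves at most one term of the series, the one with 2 (k +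
  1) = r, so for r > 0 only even moments survive. The value at r = 0 is the total mass.\<close>

lemma km_moment:
  assumes q: "q > 0"
  shows "has_bochner_integral lborel (\<lambda>\<theta>. km_angle_density q \<theta> * cos (real r * \<theta>) * indicator {0..pi} \<theta>)
    (if r = 0 then 1 else if even r then - (real q - 1) / 2 * (1 / real q) ^ (r div 2) else 0)"
proof -
  have cosr: "has_bochner_integral lborel (\<lambda>\<theta>. cos (real r * \<theta>) * indicator {0..pi} \<theta>) (if r = 0 then pi else 0)"
    using integral_cos_pi[of "int r"] by simp
  show ?thesis
  proof (cases "q = 1")
    case True
    then show ?thesis
      using has_bochner_integral_divide_zero[OF cosr, of pi]
      by (auto simp: km_angle_density_def)
  next
    case False
    define s where "s = 1 / real q"
    have s: "0 < s" "s < 1" using q False by (auto simp: s_def)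
    define f where "f k \<theta> = s ^ Suc k * (cos (real (2 * Suc k) * \<theta>) * cos (real r * \<theta>) * indicator {0..pi} \<theta>)" for k \<theta>
    have f: "has_bochner_integral lborel (f k) (s ^ Suc k * (if 2 * Suc k = r then pi / 2 else 0))" for k
      unfolding f_def by (intro has_bochner_integral_mult_right integral_cos_cos) auto
    have summ: "summable (\<lambda>k. s ^ Suc k)" using s by (simp add: summable_geometric)
    \<comment> \<open>A geometric series times the indicator of [0, pi] dominates, which justifies
      integrating term by term.\<close>
    have bound: "norm (f k \<theta>) \<le> s ^ Suc k * indicator {0..pi} \<theta>" for k \<theta>
    proof -
      have "\<bar>cos (real (2 * Suc k) * \<theta>)\<bar> * \<bar>cos (real r * \<theta>)\<bar> \<le> 1 * 1"
        by (intro mult_mono abs_cos_le_one) auto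
      then show ?thesis using s unfolding f_def
        by (simp add: abs_mult mult_left_le split: split_indicator)
    qed
    have int_ind: "has_bochner_integral lborel (\<lambda>\<theta>. indicator {0..pi} \<theta>) pi"
      using integral_cos_pi[of 0] by simp
    have A: "AE \<theta> in lborel. summable (\<lambda>k. norm (f k \<theta>))"
    proof (rule AE_I2)
      fix \<theta> show "summable (\<lambda>k. norm (f k \<theta>))"
        by (rule summable_comparison_test'[OF summable_mult2[OF summ, of "indicator {0..pi} \<theta>"]])
           (use bound in simp)
    qed
    have S: "summable (\<lambda>k. LINT \<theta>|lborel. norm (f k \<theta>))"
    proof (rule summable_comparison_test'[OF summable_mult2[OF summ, of pi]])
      fix k
      have "(LINT \<theta>|lborel. norm (f k \<theta>)) \<le> (LINT \<theta>|lborel. s ^ Suc k * indicator {0..pi} \<theta>)"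
        using f bound int_ind
        by (intro integral_mono integrable_norm integrable_mult_right) (auto simp: has_bochner_integral_iff)
      also have "\<dots> = s ^ Suc k * pi"
        using int_ind by (simp add: has_bochner_integral_iff)
      finally show "norm (LINT \<theta>|lborel. norm (f k \<theta>)) \<le> s ^ Suc k * pi" by simp
    qed
    have intf: "integrable lborel (f k)" for k using f has_bochner_integral_iff by blast
    have lim: "(\<lambda>k. LINT \<theta>|lborel. f k \<theta>) sums (LINT \<theta>|lborel. (\<Sum>k. f k \<theta>))"
      by (rule sums_integral[OF intf A S])
    have fk: "(LINT \<theta>|lborel. f k \<theta>) = s ^ Suc k * (if 2 * Suc k = r then pi / 2 else 0)" for k
      using f has_bochner_integral_iff by blast
    have lim': "(\<lambda>k. s ^ Suc k * (if 2 * Suc k = r then pi / 2 else 0)) sums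
       (if r \<noteq> 0 \<and> even r then s ^ (r div 2) * (pi / 2) else 0)"
    proof (cases "r \<noteq> 0 \<and> even r")
      case True
      then obtain j where j: "r = 2 * Suc j" by (metis evenE mult_zero_right not0_implies_Suc)
      have "(\<lambda>k. s ^ Suc k * (if 2 * Suc k = r then pi / 2 else 0)) =
        (\<lambda>k. if k = j then s ^ Suc k * (pi / 2) else 0)"
        by (auto simp: j)
      then show ?thesis using sums_single[of j "\<lambda>k. s ^ Suc k * (pi / 2)"] True
        by (simp add: j)
    next
      case False
      then have "2 * Suc k \<noteq> r" for k by auto
      then show ?thesis using False by auto
    qed
    have val: "(LINT \<theta>|lborel. (\<Sum>k. f k \<theta>)) = (if r \<noteq> 0 \<and> even r then s ^ (r div 2) * (pi / 2) else 0)"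
      using sums_unique2[OF lim[unfolded fk] lim'] .
    have F: "has_bochner_integral lborel (\<lambda>\<theta>. \<Sum>k. f k \<theta>) (if r \<noteq> 0 \<and> even r then s ^ (r div 2) * (pi / 2) else 0)"
      unfolding has_bochner_integral_iff using integrable_suminf[OF intf A S] val by simp
    have "has_bochner_integral lborel
      (\<lambda>\<theta>. (cos (real r * \<theta>) * indicator {0..pi} \<theta> - (real q - 1) * (\<Sum>k. f k \<theta>)) / pi)
      (((if r = 0 then pi else 0) - (real q - 1) * (if r \<noteq> 0 \<and> even r then s ^ (r div 2) * (pi / 2) else 0)) / pi)"
      by (intro has_bochner_integral_divide_zero has_bochner_integral_diff has_bochner_integral_mult_right cosr F)
    moreover have "(cos (real r * \<theta>) * indicator {0..pi} \<theta> - (real q - 1) * (\<Sum>k. f k \<theta>)) / pi =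
       km_angle_density q \<theta> * cos (real r * \<theta>) * indicator {0..pi} \<theta>" for \<theta>
    proof -
      have "summable (\<lambda>k. s ^ Suc k * cos (2 * real (Suc k) * \<theta>))"
        using sums_geometric_cos[of s "2 * \<theta>"] s by (auto simp: sums_iff mult_ac)
      then have "(\<Sum>k. f k \<theta>) = (\<Sum>k. s ^ Suc k * cos (2 * real (Suc k) * \<theta>)) * (cos (real r * \<theta>) * indicator {0..pi} \<theta>)"
        unfolding f_def by (subst suminf_mult2) (auto simp: mult_ac intro!: suminf_cong)
      then show ?thesis
        by (simp add: km_angle_density_def s_def[symmetric] field_simps)
    qed
    moreover have "((if r = 0 then pi else 0) - (real q - 1) * (if r \<noteq> 0 \<and> even r then s ^ (r div 2) * (pi / 2) else 0)) / pi
      = (if r = 0 then 1 else if even r then - (real q - 1) / 2 * s ^ (r div 2) else 0)"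
      by (simp add: field_simps)
    ultimately show ?thesis unfolding s_def by (simp only:)
  qed
qed


section \<open>Change of variable from x to the angle\<close>

lemma kesten_mckay_density_nonneg:
  assumes "q > 0"
  shows "kesten_mckay_density q x \<ge> 0"
proof (cases "x \<in> {-2..2}")
  case True
  then have x: "x\<^sup>2 \<le> 4" using abs_le_square_iff[of x 2] by auto
  \<comment> \<open>Two positive numbers with product 1 have sum at least 2, so the denominator is
    never negative on [-2, 2].\<close>
  have "(sqrt (real q) + 1 / sqrt (real q))\<^sup>2 \<ge> 4"
  proof -
    have "0 \<le> (sqrt (real q) - 1 / sqrt (real q))\<^sup>2" by simp
    then show ?thesis using assms by (simp add: power2_sum power2_diff)
  qed
  with x show ?thesis
    by (auto simp: kesten_mckay_density_def intro!: mult_nonneg_nonneg divide_nonneg_nonneg)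
qed (simp add: kesten_mckay_density_def)

lemma kesten_mckay_density_measurable [measurable]: "kesten_mckay_density q \<in> borel_measurable borel"
  unfolding kesten_mckay_density_def by measurable

text \<open>The endpoints are excluded because for q = 1 the left side is 0 there, by division by
  zero and the vanishing sine, while the right side is 1/pi.\<close>

lemma km_angle_density_eq:
  assumes q: "q > 0" and \<theta>: "0 < \<theta>" "\<theta> < pi"
  shows "kesten_mckay_density q (- 2 * cos \<theta>) * (2 * sin \<theta>) = km_angle_density q \<theta>"
proof -
  have s0: "sin \<theta> > 0" using \<theta> by (simp add: sin_gt_zero)
  have ind: "- 2 * cos \<theta> \<in> {-2..2}"
    using cos_le_one[of \<theta>] cos_ge_minus_one[of \<theta>] by (simp del: cos_ge_minus_one)
  have "4 - (- 2 * cos \<theta>)\<^sup>2 = (2 * sin \<theta>)\<^sup>2"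
    by (simp add: power_mult_distrib sin_squared_eq)
  then have sq: "sqrt (4 - (- 2 * cos \<theta>)\<^sup>2) = 2 * sin \<theta>"
    using s0 by (simp only: real_sqrt_abs)
  show ?thesis
  proof (cases "q = 1")
    case True
    then show ?thesis
      unfolding kesten_mckay_density_def sq using ind s0 by (simp add: km_angle_density_def)
  next
    case False
    define s where "s = 1 / real q"
    have s: "0 < s" "s < 1" and qs: "real q * s = 1" using q False by (auto simp: s_def)
    define c where "c = (cos \<theta>)\<^sup>2"
    define D where "D = real q + 2 + s - 4 * c"
    have c1: "c \<le> 1" unfolding c_def using abs_cos_le_one[of \<theta>] by (simp add: abs_square_le_1)
    \<comment> \<open>q (1 - s)^2 is the value of \<open>D\<close> at c = 1, where \<open>D\<close>
      is smallest.\<close>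
    have "0 < (1 - s)\<^sup>2 * real q" using s q by simp
    also have "\<dots> = real q - 2 + s" using qs by (simp add: power2_eq_square algebra_simps)
    finally have D: "D > 0" using c1 by (simp add: D_def)
    have D_eq: "(sqrt (real q) + 1 / sqrt (real q))\<^sup>2 - (- 2 * cos \<theta>)\<^sup>2 = D"
      using q by (simp add: D_def c_def s_def power2_sum power_divide power_mult_distrib)
    have cos2: "cos (2 * \<theta>) = 2 * c - 1" by (simp add: cos_double_cos c_def)
    \<comment> \<open>Because q s = 1, the Poisson kernel denominator at the angle 2 \<theta> is s
      times the Kesten-McKay denominator.\<close>
    have den: "1 - 2 * s * cos (2 * \<theta>) + s\<^sup>2 = s * D"
      unfolding D_def cos2 using qs by (simp add: algebra_simps power2_eq_square)
    have "(\<Sum>k. s ^ Suc k * cos (2 * real (Suc k) * \<theta>)) = (s * (2 * c - 1) - s\<^sup>2) / (s * D)"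
      using sums_geometric_cos[of s "2 * \<theta>"] s unfolding den cos2[symmetric]
      by (simp add: sums_iff mult_ac)
    also have "\<dots> = (2 * c - 1 - s) / D"
      using s D by (simp add: field_simps power2_eq_square)
    finally have ser: "(\<Sum>k. s ^ Suc k * cos (2 * real (Suc k) * \<theta>)) = (2 * c - 1 - s) / D" .
    have num: "2 * (real q + 1) * (1 - c) = D - (real q - 1) * (2 * c - 1 - s)"
      unfolding D_def using qs by (simp add: algebra_simps)
    have sin2: "sin \<theta> * sin \<theta> = 1 - c"
      unfolding c_def using sin_squared_eq[of \<theta>] by (simp add: power2_eq_square)
    have "kesten_mckay_density q (- 2 * cos \<theta>) * (2 * sin \<theta>) =
        1 / (2 * pi) * ((real q + 1) * (2 * sin \<theta>) / D) * (2 * sin \<theta>)"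
      unfolding kesten_mckay_density_def sq D_eq using ind False by simp
    also have "\<dots> = (2 * (real q + 1) * (sin \<theta> * sin \<theta>)) / D / pi"
      using D by (simp add: field_simps)
    also have "\<dots> = (1 - (real q - 1) * ((2 * c - 1 - s) / D)) / pi"
      unfolding sin2 num using D by (simp add: field_simps)
    also have "\<dots> = km_angle_density q \<theta>"
      unfolding km_angle_density_def s_def[symmetric] ser ..
    finally show ?thesis .
  qed
qed

text \<open>The minus sign makes the substitution increasing on [0, pi], with derivative 2 sin
  \<theta> \<ge> 0. It costs a sign (-1)^r in the Dickson polynomials, which is harmless since the
  odd moments vanish.\<close>

lemma kesten_mckay_eq_distr:
  assumes "q > 0"
  shows "kesten_mckay q =
    distr (density lborel (\<lambda>\<theta>. ennreal (kesten_mckay_density q (- 2 * cos \<theta>) * (2 * sin \<theta>) * indicator {0..pi} \<theta>)))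
      borel (\<lambda>\<theta>. - 2 * cos \<theta>)" (is "_ = distr ?D borel ?g")
proof (rule measure_eqI)
  show "sets (kesten_mckay q) = sets (distr ?D borel ?g)" by (simp add: kesten_mckay_def)
  fix X assume "X \<in> sets (kesten_mckay q)"
  then have X[measurable]: "X \<in> sets borel" by (simp add: kesten_mckay_def)
  let ?f = "\<lambda>x. kesten_mckay_density q x * indicator X x"
  have "emeasure (kesten_mckay q) X = (\<integral>\<^sup>+x. ennreal (kesten_mckay_density q x) * indicator X x \<partial>lborel)"
    unfolding kesten_mckay_def by (rule emeasure_density) auto
  also have "\<dots> = (\<integral>\<^sup>+x. ennreal (?f x * indicator {?g 0..?g pi} x) \<partial>lborel)"
    by (intro nn_integral_cong) (auto simp: kesten_mckay_density_def split: split_indicator)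
  also have "\<dots> = (\<integral>\<^sup>+\<theta>. ennreal (?f (?g \<theta>) * (2 * sin \<theta>) * indicator {0..pi} \<theta>) \<partial>lborel)"
    by (rule nn_integral_substitution)
       (auto intro!: derivative_eq_intros continuous_intros sin_ge_zero simp: set_borel_measurable_def)
  also have "\<dots> = (\<integral>\<^sup>+\<theta>. ennreal (kesten_mckay_density q (?g \<theta>) * (2 * sin \<theta>) * indicator {0..pi} \<theta>)
      * indicator (?g -` X) \<theta> \<partial>lborel)"
    by (intro nn_integral_cong) (auto split: split_indicator)
  also have "\<dots> = emeasure ?D (?g -` X)"
    by (subst emeasure_density) (auto intro!: measurable_sets_borel[OF _ X])
  also have "\<dots> = emeasure (distr ?D borel ?g) X"
    by (subst emeasure_distr) auto
  finally show "emeasure (kesten_mckay q) X = emeasure (distr ?D borel ?g) X" .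
qed

text \<open>-2 cos \<theta> is the sum of -e^(i \<theta>) and -e^(-i \<theta>), whose product is
  1.\<close>

lemma dickson_cos: "dickson 1 r (complex_of_real (- 2 * cos \<theta>)) = of_real ((-1) ^ r * (2 * cos (real r * \<theta>)))"
proof -
  have "complex_of_real (- 2 * cos \<theta>) = - cis \<theta> + - cis (- \<theta>)"
    by (simp add: complex_eq_iff)
  then have "dickson 1 r (complex_of_real (- 2 * cos \<theta>)) = (- cis \<theta>) ^ r + (- cis (- \<theta>)) ^ r"
    by (simp only: dickson_add[of "- cis \<theta>" "- cis (- \<theta>)" 1] minus_mult_minus cis_mult add.right_inverse cis_zero)
  also have "\<dots> = (-1) ^ r * (cis (real r * \<theta>) + cis (- (real r * \<theta>)))"
    unfolding power_minus[of "cis _"] by (simp add: Complex.DeMoivre algebra_simps)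
  also have "cis (real r * \<theta>) + cis (- (real r * \<theta>)) = of_real (2 * cos (real r * \<theta>))"
    by (simp add: complex_eq_iff)
  finally show ?thesis by simp
qed


section \<open>Termwise integration of the Jacobi-Anger expansion\<close>

lemma summable_bessel_J_weights:
  fixes p :: complex
  assumes "c \<ge> 0"
  shows "summable (\<lambda>r. norm (bessel_J (Suc r) (2 * p)) * c ^ Suc r)"
proof (rule summable_comparison_test')
  let ?b = "\<lambda>r. (norm p * c) ^ r / fact r * exp ((norm p)\<^sup>2)"
  show "summable (\<lambda>r. ?b (Suc r))"
    unfolding summable_Suc_iff[of ?b] by (intro summable_mult2 summable_exp_real)
  fix r
  have "norm (bessel_J (Suc r) (2 * p)) * c ^ Suc r \<le> (norm p ^ Suc r / fact (Suc r) * exp ((norm p)\<^sup>2)) * c ^ Suc r"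
    using norm_bessel_J_le[of "Suc r" "2 * p"] assms by (intro mult_right_mono) auto
  then show "norm (norm (bessel_J (Suc r) (2 * p)) * c ^ Suc r) \<le> ?b (Suc r)"
    using assms by (simp add: power_mult_distrib mult_ac)
qed

text \<open>The factor 1 + (-1)^r expresses that odd moments vanish and even ones enter twice,
  through the 2 in \<open>dickson_cos\<close>. The correction in the trace formula has the same
  shape, so the two cancel term by term.\<close>

lemma fourier_kesten_mckay_sums:
  assumes q: "q > 0"
  shows "(\<lambda>r. \<i> ^ Suc r * bessel_J (Suc r) (2 * p) *
           of_real (- (real q - 1) / 2 * real q powr (- real (Suc r) / 2) * (1 + (-1) ^ Suc r)))
         sums (fourier_transform (kesten_mckay q) p - bessel_J 0 (2 * p))"
proof -
  let ?h = "\<lambda>\<theta>. km_angle_density q \<theta> * indicator {0..pi} \<theta>"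
  define a where "a r = \<i> ^ Suc r * bessel_J (Suc r) (2 * p) * of_real ((-1) ^ Suc r * 2)" for r
  define mom where "mom r = (if r = 0 then 1 else if even r then - (real q - 1) / 2 * (1 / real q) ^ (r div 2) else 0)" for r
  have mom: "has_bochner_integral lborel (\<lambda>\<theta>. ?h \<theta> * cos (real r * \<theta>)) (mom r)" for r
    using km_moment[OF q, of r] by (simp add: mom_def mult_ac)
  have hint: "integrable lborel ?h"
    using mom[of 0] by (simp add: has_bochner_integral_iff)
  have "fourier_transform (kesten_mckay q) p = (LINT \<theta>|lborel.
     (kesten_mckay_density q (- 2 * cos \<theta>) * (2 * sin \<theta>) * indicator {0..pi} \<theta>) *\<^sub>R exp (\<i> * p * of_real (- 2 * cos \<theta>)))"
    unfolding fourier_transform_def kesten_mckay_eq_distr[OF q]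
    by (subst integral_distr, simp, simp, subst integral_density)
       (auto intro!: AE_I2 mult_nonneg_nonneg kesten_mckay_density_nonneg q sin_ge_zero split: split_indicator)
  also have "\<dots> = (LINT \<theta>|lborel. ?h \<theta> *\<^sub>R exp (\<i> * p * of_real (- 2 * cos \<theta>)))"
  proof (rule integral_cong_AE)
    have [measurable]: "?h \<in> borel_measurable borel"
      using hint by auto
    show "(\<lambda>\<theta>. ?h \<theta> *\<^sub>R exp (\<i> * p * of_real (- 2 * cos \<theta>))) \<in> borel_measurable lborel"
      by measurable
    \<comment> \<open>\<open>km_angle_density_eq\<close> holds on the open interval, so the two
      endpoints are discarded as null sets.\<close>
    show "AE \<theta> in lborel. (kesten_mckay_density q (- 2 * cos \<theta>) * (2 * sin \<theta>) * indicator {0..pi} \<theta>) *\<^sub>R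
        exp (\<i> * p * of_real (- 2 * cos \<theta>)) = ?h \<theta> *\<^sub>R exp (\<i> * p * of_real (- 2 * cos \<theta>))"
      using AE_lborel_singleton[of 0] AE_lborel_singleton[of pi]
    proof eventually_elim
      case (elim \<theta>)
      show ?case
      proof (cases "\<theta> \<in> {0..pi}")
        case True
        with elim have "0 < \<theta>" "\<theta> < pi" by auto
        then show ?thesis using km_angle_density_eq[OF q] by (simp only:)
      qed simp
    qed
  qed measurable
  finally have FT: "fourier_transform (kesten_mckay q) p = (LINT \<theta>|lborel. ?h \<theta> *\<^sub>R exp (\<i> * p * of_real (- 2 * cos \<theta>)))" .
  define f where "f r \<theta> = (?h \<theta> * cos (real (Suc r) * \<theta>)) *\<^sub>R a r" for r \<theta>
  have f: "has_bochner_integral lborel (f r) (mom (Suc r) *\<^sub>R a r)" for r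
    unfolding f_def by (intro has_bochner_integral_scaleR_left mom)
  then have intf: "integrable lborel (f r)" for r using has_bochner_integral_iff by blast
  have suma: "summable (\<lambda>r. norm (a r))"
    using summable_mult2[OF summable_bessel_J_weights[of 1 p], of 2]
    by (simp add: a_def norm_mult norm_power)
  have bound: "norm (f r \<theta>) \<le> norm (a r) * \<bar>?h \<theta>\<bar>" for r \<theta>
  proof -
    have "\<bar>?h \<theta>\<bar> * \<bar>cos (real (Suc r) * \<theta>)\<bar> \<le> \<bar>?h \<theta>\<bar> * 1"
      by (intro mult_left_mono abs_cos_le_one) auto
    then have "\<bar>?h \<theta>\<bar> * \<bar>cos (real (Suc r) * \<theta>)\<bar> * norm (a r) \<le> \<bar>?h \<theta>\<bar> * 1 * norm (a r)"
      by (rule mult_right_mono) simp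
    then show ?thesis
      by (simp only: f_def norm_scaleR abs_mult mult_ac mult_1_right)
  qed
  have A: "AE \<theta> in lborel. summable (\<lambda>r. norm (f r \<theta>))"
  proof (rule AE_I2)
    fix \<theta> show "summable (\<lambda>r. norm (f r \<theta>))"
      by (rule summable_comparison_test'[OF summable_mult2[OF suma, of "\<bar>?h \<theta>\<bar>"]])
         (use bound in simp)
  qed
  have S: "summable (\<lambda>r. LINT \<theta>|lborel. norm (f r \<theta>))"
  proof (rule summable_comparison_test'[OF summable_mult2[OF suma, of "LINT \<theta>|lborel. \<bar>?h \<theta>\<bar>"]])
    fix r
    have "(LINT \<theta>|lborel. norm (f r \<theta>)) \<le> (LINT \<theta>|lborel. norm (a r) * \<bar>?h \<theta>\<bar>)"
      using bound by (intro integral_mono integrable_norm integrable_mult_right integrable_abs intf hint)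
    then show "norm (LINT \<theta>|lborel. norm (f r \<theta>)) \<le> norm (a r) * (LINT \<theta>|lborel. \<bar>?h \<theta>\<bar>)"
      by simp
  qed
  have fsum: "(\<Sum>r. f r \<theta>) = ?h \<theta> *\<^sub>R exp (\<i> * p * of_real (- 2 * cos \<theta>)) - ?h \<theta> *\<^sub>R bessel_J 0 (2 * p)" for \<theta>
  proof -
    have "(\<lambda>r. ?h \<theta> *\<^sub>R (\<i> ^ Suc r * bessel_J (Suc r) (2 * p) * dickson 1 (Suc r) (complex_of_real (- 2 * cos \<theta>))))
       sums (?h \<theta> *\<^sub>R (exp (\<i> * p * of_real (- 2 * cos \<theta>)) - bessel_J 0 (2 * p)))"
      by (intro sums_scaleR_right Jacobi_Anger)
    moreover have "?h \<theta> *\<^sub>R (\<i> ^ Suc r * bessel_J (Suc r) (2 * p) * dickson 1 (Suc r) (complex_of_real (- 2 * cos \<theta>))) = f r \<theta>" for r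
      unfolding dickson_cos f_def a_def by (simp only: scaleR_conv_of_real of_real_mult mult_ac)
    ultimately show ?thesis by (simp add: sums_iff scaleR_diff_right)
  qed
  have "(\<lambda>r. LINT \<theta>|lborel. f r \<theta>) sums (LINT \<theta>|lborel. (\<Sum>r. f r \<theta>))"
    by (rule sums_integral[OF intf A S])
  also have "(LINT \<theta>|lborel. (\<Sum>r. f r \<theta>)) = fourier_transform (kesten_mckay q) p - bessel_J 0 (2 * p)"
  proof -
    have J0: "has_bochner_integral lborel (\<lambda>\<theta>. ?h \<theta> *\<^sub>R bessel_J 0 (2 * p)) (1 *\<^sub>R bessel_J 0 (2 * p))"
      using mom[of 0] by (intro has_bochner_integral_scaleR_left) (simp add: mom_def)
    \<comment> \<open>Integrability of the exponential integrand comes back from the summed series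
      by adding the order 0 term; splitting the integral needs it.\<close>
    have "integrable lborel (\<lambda>\<theta>. (\<Sum>r. f r \<theta>) + ?h \<theta> *\<^sub>R bessel_J 0 (2 * p))"
      using integrable_suminf[OF intf A S] J0 by (intro Bochner_Integration.integrable_add) (auto simp: has_bochner_integral_iff)
    then have "integrable lborel (\<lambda>\<theta>. ?h \<theta> *\<^sub>R exp (\<i> * p * of_real (- 2 * cos \<theta>)))"
      unfolding fsum by simp
    then show ?thesis
      unfolding fsum FT using J0 by (subst Bochner_Integration.integral_diff) (auto simp: has_bochner_integral_iff)
  qed
  also have "(\<lambda>r. LINT \<theta>|lborel. f r \<theta>) = (\<lambda>r. \<i> ^ Suc r * bessel_J (Suc r) (2 * p) *
           of_real (- (real q - 1) / 2 * real q powr (- real (Suc r) / 2) * (1 + (-1) ^ Suc r)))"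
  proof
    fix r
    have pw: "(1 / real q) ^ k = real q powr (- real (2 * k) / 2)" for k
    proof -
      have "real q powr (- real (2 * k) / 2) = real q powr (- real k)" by simp
      also have "\<dots> = inverse (real q ^ k)" using q by (simp only: powr_minus powr_realpow of_nat_0_less_iff)
      finally show ?thesis by (simp add: power_one_over inverse_eq_divide)
    qed
    have m: "mom (Suc r) * ((-1) ^ Suc r * 2) =
       - (real q - 1) / 2 * real q powr (- real (Suc r) / 2) * (1 + (-1) ^ Suc r)"
    proof (cases "even (Suc r)")
      case True
      then obtain k where k: "Suc r = 2 * k" by (elim evenE)
      show ?thesis unfolding mom_def k using k pw[of k] by simp
    next
      case False
      then show ?thesis by (simp add: mom_def)
    qed
    have "mom (Suc r) *\<^sub>R a r = \<i> ^ Suc r * bessel_J (Suc r) (2 * p) * of_real (mom (Suc r) * ((-1) ^ Suc r * 2))"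
      unfolding a_def by (simp only: scaleR_conv_of_real of_real_mult mult_ac)
    then have "mom (Suc r) *\<^sub>R a r = \<i> ^ Suc r * bessel_J (Suc r) (2 * p) *
           of_real (- (real q - 1) / 2 * real q powr (- real (Suc r) / 2) * (1 + (-1) ^ Suc r))"
      unfolding m .
    then show "(LINT \<theta>|lborel. f r \<theta>) = \<i> ^ Suc r * bessel_J (Suc r) (2 * p) *
           of_real (- (real q - 1) / 2 * real q powr (- real (Suc r) / 2) * (1 + (-1) ^ Suc r))"
      using f[of r] by (simp only: has_bochner_integral_iff)
  qed
  finally show ?thesis .
qed

section \<open>Traces and eigenvalues of symmetric matrices\<close>

definition mat_trace :: "'a::comm_monoid_add mat \<Rightarrow> 'a" where
  "mat_trace A = (\<Sum>i<dim_row A. A $$ (i, i))"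

lemma mat_trace_minus:
  fixes A B :: "'a::ab_group_add mat"
  assumes "A \<in> carrier_mat n n" "B \<in> carrier_mat n n"
  shows "mat_trace (A - B) = mat_trace A - mat_trace B"
  using assms by (auto simp: mat_trace_def sum_subtractf)

lemma mat_trace_one: "mat_trace (1\<^sub>m n :: 'a::semiring_1 mat) = of_nat n"
  by (simp add: mat_trace_def)

lemma mat_trace_comm:
  fixes A B :: "'a::comm_semiring_0 mat"
  assumes "A \<in> carrier_mat n m" "B \<in> carrier_mat m n"
  shows "mat_trace (A * B) = mat_trace (B * A)"
proof -
  have "mat_trace (A * B) = (\<Sum>i<n. \<Sum>j<m. A $$ (i, j) * B $$ (j, i))"
    using assms by (auto simp: mat_trace_def scalar_prod_def atLeast0LessThan intro!: sum.cong)
  also have "\<dots> = (\<Sum>j<m. \<Sum>i<n. B $$ (j, i) * A $$ (i, j))"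
    by (subst sum.swap) (simp add: mult.commute)
  also have "\<dots> = mat_trace (B * A)"
    using assms by (auto simp: mat_trace_def scalar_prod_def atLeast0LessThan intro!: sum.cong)
  finally show ?thesis .
qed

lemma upper_triangular_mult:
  fixes A B :: "'a::semiring_0 mat"
  assumes A: "A \<in> carrier_mat n n" "upper_triangular A"
    and B: "B \<in> carrier_mat n n" "upper_triangular B"
  shows "upper_triangular (A * B)" "i < n \<Longrightarrow> (A * B) $$ (i, i) = A $$ (i, i) * B $$ (i, i)"
proof -
  have entry: "(A * B) $$ (i, j) = (\<Sum>k<n. A $$ (i, k) * B $$ (k, j))" if "i < n" "j < n" for i j
    using that A(1) B(1) by (auto simp: scalar_prod_def atLeast0LessThan intro!: sum.cong)
  have zero: "A $$ (i, k) * B $$ (k, j) = 0" if "k < i \<or> j < k" "i < n" "k < n" for i j k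
    using that A B upper_triangularD[of A k i] upper_triangularD[of B j k] by auto
  show "upper_triangular (A * B)"
  proof (rule upper_triangularI)
    fix i j assume *: "j < i" "i < dim_row (A * B)"
    then show "(A * B) $$ (i, j) = 0"
      using A(1) by (subst entry) (auto intro!: sum.neutral zero)
  qed
  show "(A * B) $$ (i, i) = A $$ (i, i) * B $$ (i, i)" if "i < n"
  proof -
    have "(\<Sum>k<n. A $$ (i, k) * B $$ (k, i)) = (\<Sum>k<n. if k = i then A $$ (i, i) * B $$ (i, i) else 0)"
      using that zero by (intro sum.cong) (auto simp: neq_iff)
    also have "\<dots> = A $$ (i, i) * B $$ (i, i)"
      using that by simp
    finally show ?thesis using that by (simp add: entry)
  qed
qed

text \<open>For an eigenvector v the Hermitian form of \<open>A\<close> at v, called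
  \<open>S\<close>, equals k |v|^2, and symmetry makes it its own conjugate; \<open>N\<close> is
  |v|^2.\<close>

lemma real_symmetric_eigenvalue_real:
  fixes A :: "real mat"
  assumes A: "A \<in> carrier_mat n n" and sym: "transpose_mat A = A"
    and ev: "eigenvalue (map_mat complex_of_real A) k"
  shows "k \<in> \<real>"
proof -
  define C where "C = map_mat complex_of_real A"
  have C: "C \<in> carrier_mat n n" using A by (simp add: C_def)
  obtain v where v: "v \<in> carrier_vec n" "v \<noteq> 0\<^sub>v n" and Cv: "C *\<^sub>v v = k \<cdot>\<^sub>v v"
    using ev C unfolding eigenvalue_def eigenvector_def C_def[symmetric] by auto
  define f where "f i = vec_index v i" for i
  have *: "(\<Sum>j<n. of_real (A $$ (i, j)) * f j) = k * f i" if "i < n" for i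
  proof -
    have "vec_index (C *\<^sub>v v) i = (\<Sum>j<n. of_real (A $$ (i, j)) * f j)"
      using that v(1) A by (auto simp: C_def f_def scalar_prod_def atLeast0LessThan intro!: sum.cong)
    then show ?thesis using Cv that v(1) by (simp add: f_def)
  qed
  have symA: "A $$ (i, j) = A $$ (j, i)" if "i < n" "j < n" for i j
    using that sym A by (metis carrier_matD index_transpose_mat(1))
  define N where "N = (\<Sum>i<n. (norm (f i))\<^sup>2)"
  have norms: "cnj (f i) * f i = of_real ((norm (f i))\<^sup>2)" for i
    by (metis complex_norm_square mult.commute)
  define S where "S = (\<Sum>i<n. \<Sum>j<n. cnj (f i) * of_real (A $$ (i, j)) * f j)"
  have "S = (\<Sum>i<n. cnj (f i) * (k * f i))"
    unfolding S_def by (intro sum.cong) (auto simp: *[symmetric] sum_distrib_left mult.assoc)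
  also have "\<dots> = k * of_real N"
    unfolding N_def of_real_sum norms[symmetric] by (simp add: sum_distrib_left mult_ac)
  finally have S: "S = k * of_real N" .
  have "cnj S = (\<Sum>i<n. \<Sum>j<n. cnj (f j) * of_real (A $$ (j, i)) * f i)"
    unfolding S_def cnj_sum by (intro sum.cong) (auto simp: symA mult_ac)
  also have "\<dots> = S"
    unfolding S_def by (rule sum.swap)
  finally have "cnj k * of_real N = k * of_real N" by (simp add: S)
  moreover have "N \<noteq> 0"
  proof
    assume "N = 0"
    then have "f i = 0" if "i < n" for i
      using that unfolding N_def by (subst (asm) sum_nonneg_eq_0_iff) auto
    then have "v = 0\<^sub>v n" using v(1) by (intro eq_vecI) (auto simp: f_def)
    with v(2) show False by simp
  qed
  ultimately have "cnj k = k" by simp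
  then show ?thesis by (simp add: Reals_cnj_iff)
qed

text \<open>The complex factorization has real roots, and comparing coefficients brings it back to
  the reals, where the Schur decomposition demands a split characteristic polynomial.\<close>

lemma real_symmetric_char_poly_splits:
  fixes A :: "real mat"
  assumes A: "A \<in> carrier_mat n n" and sym: "transpose_mat A = A"
  obtains es where "char_poly A = (\<Prod>e\<leftarrow>es. [:- e, 1:])" "length es = n"
proof -
  let ?C = "map_mat complex_of_real A"
  interpret map_poly_comm_ring_hom complex_of_real ..
  have C: "?C \<in> carrier_mat n n" using A by simp
  obtain as where as: "char_poly ?C = (\<Prod>a\<leftarrow>as. [:- a, 1:])" "length as = n"
    using char_poly_factorized[OF C] by blast
  have real: "a \<in> \<real>" if "a \<in> set as" for a
  proof -
    have "poly (char_poly ?C) a = 0"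
      using that unfolding as(1) poly_prod_list prod_list_zero_iff by (force simp: image_iff)
    then show ?thesis
      using real_symmetric_eigenvalue_real[OF A sym] eigenvalue_root_char_poly[OF C] by blast
  qed
  define es where "es = map Re as"
  have as_es: "as = map of_real es"
    unfolding es_def using real by (auto simp: map_idI o_def)
  have "map_poly complex_of_real (char_poly A) = char_poly ?C"
    using of_real_hom.char_poly_hom[OF A] by metis
  also have "\<dots> = map_poly of_real (\<Prod>e\<leftarrow>es. [:- e, 1:])"
    unfolding as(1) as_es by (simp add: hom_prod_list o_def)
  finally have "char_poly A = (\<Prod>e\<leftarrow>es. [:- e, 1:])"
    by (simp add: poly_eq_iff coeff_map_poly)
  moreover have "length es = n" using as(2) by (simp add: es_def)
  ultimately show ?thesis using that by blast
qed

lemma proots_prod_list_linear: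
  "proots (\<Prod>e\<leftarrow>es. [:- e, 1:] :: 'a::idom poly) = mset es"
proof -
  have nz: "(\<Prod>e\<leftarrow>es. [:- e, 1:] :: 'a poly) \<noteq> 0" for es :: "'a list"
    by auto
  show ?thesis
  proof (induction es)
    case (Cons e es)
    then show ?case using nz[of es] nz[of "e # es"] by (simp add: proots_mult del: mult_pCons_left)
  qed simp
qed

text \<open>A triangular form takes the place of a diagonalization: diagonals of upper triangular
  matrices subtract and multiply entrywise, which is all that traces of polynomials in
  \<open>A\<close> require.\<close>

locale triangularization =
  fixes A P Q T :: "real mat" and n :: nat and es :: "real list"
  assumes A: "A \<in> carrier_mat n n"
    and sim: "similar_mat_wit A T P Q"
    and ut: "upper_triangular T"
    and diag: "diag_mat T = es"
begin

lemma carrier: "P \<in> carrier_mat n n" "Q \<in> carrier_mat n n" "T \<in> carrier_mat n n"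
  and PQ: "P * Q = 1\<^sub>m n" and QP: "Q * P = 1\<^sub>m n" and A_eq: "A = P * T * Q"
  using similar_mat_witD2[OF A sim] by auto

lemma length_es: "length es = n"
  using diag carrier by (auto simp: diag_mat_def)

text \<open>
  This relation is stable under the ring operations, so the trace of any polynomial expression
  in \<open>A\<close> becomes a sum over the eigenvalues.
\<close>

definition spectral_rep :: "real mat \<Rightarrow> (real \<Rightarrow> real) \<Rightarrow> bool" where
  "spectral_rep M f \<longleftrightarrow> (\<exists>U\<in>carrier_mat n n. M = P * U * Q \<and> upper_triangular U \<and>
      (\<forall>i<n. U $$ (i, i) = f (es ! i)))"

lemma spectral_rep_self: "spectral_rep A (\<lambda>x. x)"
  unfolding spectral_rep_def using carrier A_eq ut diag
  by (intro bexI[of _ T]) (auto simp: diag_mat_def)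

lemma spectral_rep_one: "spectral_rep (1\<^sub>m n) (\<lambda>x. 1)"
  unfolding spectral_rep_def using carrier PQ
  by (intro bexI[of _ "1\<^sub>m n"]) auto

lemma spectral_rep_smult:
  assumes "spectral_rep M f"
  shows "spectral_rep (k \<cdot>\<^sub>m M) (\<lambda>x. k * f x)"
proof -
  obtain U where U: "U \<in> carrier_mat n n" "M = P * U * Q" "upper_triangular U"
    "\<forall>i<n. U $$ (i, i) = f (es ! i)" using assms unfolding spectral_rep_def by blast
  have "k \<cdot>\<^sub>m M = P * (k \<cdot>\<^sub>m U) * Q"
    unfolding U(2) using carrier U(1)
    by (simp add: mult_smult_distrib[of P n n U n] mult_smult_assoc_mat[of "P * U" n n Q n])
  moreover have "upper_triangular (k \<cdot>\<^sub>m U)"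
    using U(1) upper_triangularD[OF U(3)] by (intro upper_triangularI) auto
  ultimately show ?thesis
    unfolding spectral_rep_def using U by (intro bexI[of _ "k \<cdot>\<^sub>m U"]) auto
qed

lemma spectral_rep_minus:
  assumes "spectral_rep M f" "spectral_rep N g"
  shows "spectral_rep (M - N) (\<lambda>x. f x - g x)"
proof -
  obtain U where U: "U \<in> carrier_mat n n" "M = P * U * Q" "upper_triangular U"
    "\<forall>i<n. U $$ (i, i) = f (es ! i)" using assms(1) unfolding spectral_rep_def by blast
  obtain W where W: "W \<in> carrier_mat n n" "N = P * W * Q" "upper_triangular W"
    "\<forall>i<n. W $$ (i, i) = g (es ! i)" using assms(2) unfolding spectral_rep_def by blast
  have "M - N = P * (U - W) * Q"
    unfolding U(2) W(2) using carrier U(1) W(1)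
    by (simp add: mult_minus_distrib_mat[of P n n U n W] minus_mult_distrib_mat[of "P * U" n n "P * W" Q n])
  moreover have "upper_triangular (U - W)"
    using U(1) W(1) upper_triangularD[OF U(3)] upper_triangularD[OF W(3)]
    by (intro upper_triangularI) auto
  ultimately show ?thesis
    unfolding spectral_rep_def using U W by (intro bexI[of _ "U - W"]) auto
qed

lemma spectral_rep_mult:
  assumes "spectral_rep M f" "spectral_rep N g"
  shows "spectral_rep (M * N) (\<lambda>x. f x * g x)"
proof -
  obtain U where U: "U \<in> carrier_mat n n" "M = P * U * Q" "upper_triangular U"
    "\<forall>i<n. U $$ (i, i) = f (es ! i)" using assms(1) unfolding spectral_rep_def by blast
  obtain W where W: "W \<in> carrier_mat n n" "N = P * W * Q" "upper_triangular W"
    "\<forall>i<n. W $$ (i, i) = g (es ! i)" using assms(2) unfolding spectral_rep_def by blast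
  have "M * N = P * (U * ((Q * P) * (W * Q)))"
    unfolding U(2) W(2) using carrier U(1) W(1)
    by (simp add: assoc_mult_mat[of _ n n _ n _ n])
  also have "\<dots> = P * (U * W) * Q"
    unfolding QP using carrier U(1) W(1) by (simp add: assoc_mult_mat[of _ n n _ n _ n])
  finally have "M * N = P * (U * W) * Q" .
  then show ?thesis
    unfolding spectral_rep_def using U W upper_triangular_mult[OF U(1,3) W(1,3)]
    by (intro bexI[of _ "U * W"]) auto
qed

lemma spectral_rep_trace:
  assumes "spectral_rep M f"
  shows "mat_trace M = (\<Sum>x\<leftarrow>es. f x)"
proof -
  obtain U where U: "U \<in> carrier_mat n n" "M = P * U * Q" "upper_triangular U"
    "\<forall>i<n. U $$ (i, i) = f (es ! i)" using assms(1) unfolding spectral_rep_def by blast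
  have "mat_trace M = mat_trace (Q * (P * U))"
    unfolding U(2) by (rule mat_trace_comm) (use carrier U(1) in auto)
  also have "Q * (P * U) = U"
    using carrier U(1) QP assoc_mult_mat[of Q n n P n U n] by simp
  also have "mat_trace U = (\<Sum>i<n. f (es ! i))"
    using U by (auto simp: mat_trace_def)
  also have "\<dots> = (\<Sum>x\<leftarrow>es. f x)"
    using length_es by (simp add: sum_list_sum_nth atLeast0LessThan)
  finally show ?thesis .
qed

end


section \<open>Traces of powers of the non-backtracking matrix\<close>

text \<open>
  The two components are the polynomials in the adjacency matrix \<open>A\<close> that represent
  \<open>Ot * B ^\<^sub>m r * H\<close> and \<open>Ot * B ^\<^sub>m r * O'\<close> in the locale \<open>hashimoto\<close>.
\<close>

primrec nb_poly :: "real \<Rightarrow> nat \<Rightarrow> real \<Rightarrow> real \<times> real" where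
  "nb_poly q 0 x = (x, q + 1)"
| "nb_poly q (Suc r) x = (fst (nb_poly q r x) * x - snd (nb_poly q r x), q * fst (nb_poly q r x))"

text \<open>Both sides satisfy f(r + 2) = x f(r + 1) - q f(r) and agree at r = 0, where they are x^2
  - 2 q - 2, and at r = 1.\<close>

lemma nb_poly_dickson:
  "fst (nb_poly q (Suc r) x) - snd (nb_poly q r x) = dickson q (Suc (Suc r)) x - dickson q r x"
proof (induction r rule: induct_nat_012)
  case (ge2 r)
  have "fst (nb_poly q (Suc (Suc (Suc r))) x) - snd (nb_poly q (Suc (Suc r)) x) =
      x * (fst (nb_poly q (Suc (Suc r)) x) - snd (nb_poly q (Suc r) x))
      - q * (fst (nb_poly q (Suc r) x) - snd (nb_poly q r x))"
    by (simp add: algebra_simps)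
  then show ?case unfolding ge2 by (simp add: algebra_simps)
qed (simp_all add: algebra_simps)

text \<open>The graph enters through these identities alone: \<open>OtO\<close> is regularity,
  \<open>JH\<close> and \<open>JO\<close> exchange heads and tails, \<open>trJ\<close> reflects that
  no arc is its own reverse, and \<open>m\<close> counts the arcs.\<close>

locale hashimoto = triangularization +
  fixes m :: nat and q :: real and H O' Ot J B :: "real mat"
  assumes carr: "H \<in> carrier_mat m n" "O' \<in> carrier_mat m n" "Ot \<in> carrier_mat n m" "J \<in> carrier_mat m m"
    and OtH: "Ot * H = A" and OtO: "Ot * O' = (q + 1) \<cdot>\<^sub>m 1\<^sub>m n"
    and JH: "J * H = O'" and JO: "J * O' = H" and JJ: "J * J = 1\<^sub>m m" and trJ: "mat_trace J = 0"
    and m: "real m = (q + 1) * real n"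
    and B_eq: "B = H * Ot - J"
begin

lemma B_carrier: "B \<in> carrier_mat m m"
  unfolding B_eq using carr by (intro minus_carrier_mat) auto

lemma Bpow_carrier: "B ^\<^sub>m r \<in> carrier_mat m m"
  using B_carrier by simp

lemma BH: "B * H = H * A - O'"
proof -
  have "B * H = H * Ot * H - J * H"
    unfolding B_eq using carr by (intro minus_mult_distrib_mat[of _ m m]) auto
  also have "H * Ot * H = H * A"
    using carr by (simp add: assoc_mult_mat[of H m n Ot m H n] OtH)
  finally show ?thesis by (simp add: JH)
qed

lemma BO: "B * O' = q \<cdot>\<^sub>m H"
proof -
  have "B * O' = H * Ot * O' - J * O'"
    unfolding B_eq using carr by (intro minus_mult_distrib_mat[of _ m m]) auto
  also have "H * Ot * O' = (q + 1) \<cdot>\<^sub>m H"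
    using carr by (simp add: assoc_mult_mat[of H m n Ot m O' n] OtO mult_smult_distrib[of H m n _ n])
  also have "(q + 1) \<cdot>\<^sub>m H - J * O' = q \<cdot>\<^sub>m H"
    unfolding JO using carr by (intro eq_matI) (auto simp: algebra_simps)
  finally show ?thesis .
qed

text \<open>\<open>BH\<close> and \<open>BO\<close> leave \<open>A\<close> to the right of
  \<open>H\<close>, so it can be pulled out of the product, and each step closes on the same pair of
  matrices.\<close>

lemma spectral_rep_nb:
  "spectral_rep (Ot * (B ^\<^sub>m r * H)) (\<lambda>x. fst (nb_poly q r x)) \<and>
   spectral_rep (Ot * (B ^\<^sub>m r * O')) (\<lambda>x. snd (nb_poly q r x))"
proof (induction r)
  case 0
  have "spectral_rep ((q + 1) \<cdot>\<^sub>m 1\<^sub>m n) (\<lambda>x. (q + 1) * 1)"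
    by (intro spectral_rep_smult spectral_rep_one)
  then show ?case
    using spectral_rep_self carr B_carrier by (simp add: OtH OtO)
next
  case (Suc r)
  let ?P = "B ^\<^sub>m r"
  have "Ot * (B ^\<^sub>m Suc r * H) = Ot * (?P * (H * A - O'))"
    using carr B_carrier Bpow_carrier[of r] assoc_mult_mat[of ?P m m B m H n] by (simp add: BH)
  also have "?P * (H * A - O') = ?P * H * A - ?P * O'"
    using carr A Bpow_carrier[of r] mult_minus_distrib_mat[of ?P m m "H * A" n O']
      assoc_mult_mat[of ?P m m H n A n] by auto
  also have "Ot * (?P * H * A - ?P * O') = Ot * (?P * H) * A - Ot * (?P * O')"
    using carr A Bpow_carrier[of r] mult_minus_distrib_mat[of Ot n m "?P * H * A" n "?P * O'"]
      assoc_mult_mat[of Ot n m "?P * H" n A n] by auto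
  finally have 1: "Ot * (B ^\<^sub>m Suc r * H) = Ot * (?P * H) * A - Ot * (?P * O')" .
  have "Ot * (B ^\<^sub>m Suc r * O') = Ot * (?P * (q \<cdot>\<^sub>m H))"
    using carr B_carrier Bpow_carrier[of r] assoc_mult_mat[of ?P m m B m O' n] by (simp add: BO)
  also have "\<dots> = q \<cdot>\<^sub>m (Ot * (?P * H))"
    using carr Bpow_carrier[of r] mult_smult_distrib[of ?P m m H n q]
      mult_smult_distrib[of Ot n m "?P * H" n q] by auto
  finally have 2: "Ot * (B ^\<^sub>m Suc r * O') = q \<cdot>\<^sub>m (Ot * (?P * H))" .
  show ?case
    unfolding 1 2 nb_poly.simps fst_conv snd_conv using Suc
    by (intro conjI spectral_rep_minus spectral_rep_mult spectral_rep_smult spectral_rep_self) auto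
qed

text \<open>One factor is written as H Ot - J. Cyclic rotation puts \<open>J\<close> in front of
  another factor, and J B = O' Ot - 1; the -1 yields the trace of the power
  \<open>r\<close>.\<close>

lemma trace_Bpow_rec:
  "mat_trace (B ^\<^sub>m Suc (Suc r)) - mat_trace (B ^\<^sub>m r) =
     mat_trace (Ot * (B ^\<^sub>m Suc r * H)) - mat_trace (Ot * (B ^\<^sub>m r * O'))"
proof -
  define P' S where "P' = B ^\<^sub>m r" and "S = B ^\<^sub>m Suc r"
  have c: "P' \<in> carrier_mat m m" "S \<in> carrier_mat m m" "H * Ot \<in> carrier_mat m m"
    unfolding P'_def S_def using carr by (auto intro: Bpow_carrier simp del: pow_mat.simps)
  \<comment> \<open>Powers are built by multiplication on the right, but rotation brings
    \<open>J\<close> to the left end, so a factor \<open>B\<close> has to stand there.\<close>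
  have comm: "S = B * P'"
    unfolding P'_def S_def
  proof (induction r)
    case (Suc r)
    then show ?case
      using B_carrier assoc_mult_mat[of B m m "B ^\<^sub>m r" m B m] by simp
  qed (use B_carrier in simp)
  have "B ^\<^sub>m Suc (Suc r) = S * B" by (simp add: S_def)
  also have "\<dots> = S * (H * Ot) - S * J"
    unfolding B_eq by (rule mult_minus_distrib_mat[OF c(2,3) carr(4)])
  finally have "mat_trace (B ^\<^sub>m Suc (Suc r)) = mat_trace (S * (H * Ot)) - mat_trace (S * J)"
    using c carr by (simp add: mat_trace_minus[of _ m])
  also have "mat_trace (S * (H * Ot)) = mat_trace (Ot * (S * H))"
    using assoc_mult_mat[OF c(2) carr(1,3)] mat_trace_comm[of "S * H" m n Ot] c carr by simp
  also have "mat_trace (S * J) = mat_trace (J * B * P')"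
    using mat_trace_comm[OF c(2) carr(4)] assoc_mult_mat[OF carr(4) B_carrier c(1)] by (simp add: comm)
  also have "J * B = O' * Ot - 1\<^sub>m m"
    unfolding B_eq mult_minus_distrib_mat[OF carr(4) c(3) carr(4)]
      assoc_mult_mat[OF carr(4,1,3), symmetric] JH JJ ..
  also have "(O' * Ot - 1\<^sub>m m) * P' = O' * (Ot * P') - P'"
    using minus_mult_distrib_mat[of "O' * Ot" m m "1\<^sub>m m" P' m] assoc_mult_mat[OF carr(2,3) c(1)] c carr
    by simp
  also have "mat_trace \<dots> = mat_trace (O' * (Ot * P')) - mat_trace P'"
    using c carr by (intro mat_trace_minus[of _ m]) auto
  also have "mat_trace (O' * (Ot * P')) = mat_trace (Ot * (P' * O'))"
    using mat_trace_comm[of O' m n "Ot * P'"] assoc_mult_mat[OF carr(3) c(1) carr(2)] c carr by simp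
  finally show ?thesis by (simp add: P'_def S_def)
qed

text \<open>At r = 0 there are m = (q + 1) n arcs against the Dickson total 2 n, an excess of (q -
  1) n. At r = 1 there is none, by \<open>trJ\<close>. Steps of two carry both values along.\<close>

lemma trace_Bpow:
  "mat_trace (B ^\<^sub>m r) = (\<Sum>x\<leftarrow>es. dickson q r x) + (q - 1) * real n / 2 * (1 + (-1) ^ r)"
proof (induction r rule: induct_nat_012)
  case 0
  have "(\<Sum>x\<leftarrow>es. dickson q 0 x) = 2 * real n"
    using length_es by (simp add: sum_list_triv)
  then show ?case
    using B_carrier m by (simp add: mat_trace_one field_simps)
next
  case 1
  have "mat_trace B = mat_trace (H * Ot)"
    unfolding B_eq using carr mat_trace_minus[of "H * Ot" m J] trJ by auto
  also have "\<dots> = mat_trace A"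
    using carr mat_trace_comm[of H m n Ot] by (simp add: OtH)
  also have "\<dots> = (\<Sum>x\<leftarrow>es. x)"
    using spectral_rep_trace[OF spectral_rep_self] by simp
  finally show ?case using B_carrier by simp
next
  case (ge2 r)
  have "mat_trace (B ^\<^sub>m Suc (Suc r)) - mat_trace (B ^\<^sub>m r) =
      (\<Sum>x\<leftarrow>es. fst (nb_poly q (Suc r) x)) - (\<Sum>x\<leftarrow>es. snd (nb_poly q r x))"
    unfolding trace_Bpow_rec
    using spectral_rep_trace spectral_rep_nb[of "Suc r"] spectral_rep_nb[of r] by metis
  also have "\<dots> = (\<Sum>x\<leftarrow>es. dickson q (Suc (Suc r)) x) - (\<Sum>x\<leftarrow>es. dickson q r x)"
    unfolding sum_list_subtractf[symmetric] nb_poly_dickson ..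
  finally show ?case using ge2(1) by simp
qed

end

section \<open>Circuits\<close>

text \<open>\<open>f\<close> is the arc that follows the list, so \<open>r\<close> arcs record
  \<open>r\<close> steps, and for f = e the closing step of a circuit is an ordinary one. Taking the
  head of \<open>es @ [f]\<close> makes r = 0 the identity relation.\<close>

definition chains :: "('b \<Rightarrow> 'b \<Rightarrow> bool) \<Rightarrow> 'b set \<Rightarrow> nat \<Rightarrow> 'b \<Rightarrow> 'b \<Rightarrow> 'b list set" where
  "chains R E r e f = {es. length es = r \<and> set es \<subseteq> E \<and> hd (es @ [f]) = e \<and> successively R (es @ [f])}"

lemma chains_0: "chains R E 0 e f = (if e = f then {[]} else {})"
  by (auto simp: chains_def)

lemma finite_chains: "finite E \<Longrightarrow> finite (chains R E r e f)"
  by (rule finite_subset[OF _ finite_lists_length_eq[of E r]]) (auto simp: chains_def)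

lemma card_chains_Suc:
  assumes "finite E"
  shows "card (chains R E (Suc r) e f) = (\<Sum>g\<in>E. card (chains R E r e g) * of_bool (R g f))"
proof -
  let ?S = "\<lambda>g. (\<lambda>es. es @ [g]) ` chains R E r e g"
  have "chains R E (Suc r) e f = (\<Union>g\<in>{g\<in>E. R g f}. ?S g)"
  proof (intro equalityI subsetI)
    fix xs assume xs: "xs \<in> chains R E (Suc r) e f"
    then obtain es g where es: "xs = es @ [g]"
      by (cases xs rule: rev_cases) (auto simp: chains_def)
    show "xs \<in> (\<Union>g\<in>{g\<in>E. R g f}. ?S g)"
      using xs unfolding es by (auto simp: chains_def successively_append_iff hd_append split: if_splits)
  next
    fix xs assume "xs \<in> (\<Union>g\<in>{g\<in>E. R g f}. ?S g)"
    then show "xs \<in> chains R E (Suc r) e f"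
      by (auto simp: chains_def successively_append_iff hd_append split: if_splits)
  qed
  also have "card \<dots> = (\<Sum>g\<in>{g\<in>E. R g f}. card (?S g))"
    by (rule card_UN_disjoint) (use assms in \<open>auto simp: finite_chains\<close>)
  also have "\<dots> = (\<Sum>g\<in>{g\<in>E. R g f}. card (chains R E r e g))"
    by (intro sum.cong refl card_image) (auto simp: inj_on_def)
  also have "\<dots> = (\<Sum>g\<in>E. card (chains R E r e g) * of_bool (R g f))"
    using assms by (simp add: sum.inter_filter of_bool_def if_distrib cong: if_cong)
  finally show ?thesis .
qed

lemma mat_mult_mat:
  "Matrix.mat a b f * Matrix.mat b c g = Matrix.mat a c (\<lambda>(i, j). \<Sum>k<b. f (i, k) * (g (k, j) :: 'a::semiring_0))"
  by (intro eq_matI) (auto simp: scalar_prod_def atLeast0LessThan)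

locale finite_bidirected = fin_digraph G + bidirected_digraph G arev
  for G :: "('a, 'b) pre_digraph" and arev
begin

definition nb_step :: "'b \<Rightarrow> 'b \<Rightarrow> bool" where
  "nb_step e f \<longleftrightarrow> head G e = tail G f \<and> f \<noteq> arev e"

lemma is_circuit_iff:
  "is_circuit G arev es \<longleftrightarrow> es \<noteq> [] \<and> es \<in> chains nb_step (arcs G) (length es) (hd es) (hd es)"
proof (cases "es = []")
  case False
  have "successively nb_step es \<longleftrightarrow> (\<forall>i. Suc i < length es \<longrightarrow>
      head G (es ! i) = tail G (es ! Suc i) \<and> es ! Suc i \<noteq> arev (es ! i))"
    by (simp add: successively_conv_nth nb_step_def)
  moreover have "successively nb_step (es @ [hd es]) \<longleftrightarrow>
      successively nb_step es \<and> head G (last es) = tail G (hd es) \<and> hd es \<noteq> arev (last es)"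
    using False by (simp add: successively_append_iff nb_step_def)
  ultimately show ?thesis
    using False by (auto simp: is_circuit_def chains_def)
qed (simp add: is_circuit_def)

text \<open>Positive length lets the list determine its first arc, so the union over it is disjoint;
  at length 0 the empty list would be counted once per arc.\<close>

lemma circuit_count_eq:
  assumes "r > 0"
  shows "circuit_count G arev r = (\<Sum>e\<in>arcs G. card (chains nb_step (arcs G) r e e))"
proof -
  have "{es. is_circuit G arev es \<and> length es = r} = (\<Union>e\<in>arcs G. chains nb_step (arcs G) r e e)"
    using assms by (auto simp: is_circuit_iff) (auto simp: chains_def hd_append split: if_splits)
  moreover have "disjoint_family_on (\<lambda>e. chains nb_step (arcs G) r e e) (arcs G)"
    using assms by (auto simp: disjoint_family_on_def chains_def hd_append split: if_splits)
  ultimately show ?thesis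
    unfolding circuit_count_def using finite_chains[of "arcs G" nb_step]
    by (simp add: card_UN_disjoint disjoint_family_on_def)
qed

text \<open>Counting all lists of arcs is crude, but the factorial in the Bessel bound absorbs
  it.\<close>

lemma circuit_count_le: "circuit_count G arev r \<le> card (arcs G) ^ r"
proof -
  have "{es. is_circuit G arev es \<and> length es = r} \<subseteq> {es. set es \<subseteq> arcs G \<and> length es = r}"
    by (auto simp: is_circuit_def)
  then show ?thesis
    unfolding circuit_count_def
    using card_mono[OF finite_lists_length_eq[of "arcs G" r]] card_lists_length_eq[of "arcs G" r] by simp
qed

section \<open>Incidence matrices of the graph\<close>

abbreviation nv :: nat where "nv \<equiv> card (verts G)"
abbreviation ne :: nat where "ne \<equiv> card (arcs G)"
abbreviation nth_vert :: "nat \<Rightarrow> 'a" where "nth_vert \<equiv> from_nat_into (verts G)"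
abbreviation nth_arc :: "nat \<Rightarrow> 'b" where "nth_arc \<equiv> from_nat_into (arcs G)"

lemma bij_vert: "bij_betw nth_vert {..<nv} (verts G)" and bij_arc: "bij_betw nth_arc {..<ne} (arcs G)"
  by (auto intro: bij_betw_from_nat_into_finite)

lemma arc_in: "i < ne \<Longrightarrow> nth_arc i \<in> arcs G"
  using bij_arc by (auto simp: bij_betw_def)

lemma vert_in: "i < nv \<Longrightarrow> nth_vert i \<in> verts G"
  using bij_vert by (auto simp: bij_betw_def)

lemma arc_eq_iff: "i < ne \<Longrightarrow> j < ne \<Longrightarrow> nth_arc i = nth_arc j \<longleftrightarrow> i = j"
  using bij_arc by (auto simp: bij_betw_def inj_on_def)

lemma vert_eq_iff: "i < nv \<Longrightarrow> j < nv \<Longrightarrow> nth_vert i = nth_vert j \<longleftrightarrow> i = j"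
  using bij_vert by (auto simp: bij_betw_def inj_on_def)

lemma sum_arc: "(\<Sum>i<ne. f (nth_arc i)) = (\<Sum>e\<in>arcs G. f e)"
  by (rule sum.reindex_bij_betw[OF bij_arc])

lemma sum_vert: "(\<Sum>i<nv. f (nth_vert i)) = (\<Sum>v\<in>verts G. f v)"
  by (rule sum.reindex_bij_betw[OF bij_vert])

definition head_mat :: "real mat" where
  "head_mat = Matrix.mat ne nv (\<lambda>(i, j). of_bool (head G (nth_arc i) = nth_vert j))"

definition tail_mat :: "real mat" where
  "tail_mat = Matrix.mat ne nv (\<lambda>(i, j). of_bool (tail G (nth_arc i) = nth_vert j))"

definition tail_mat_t :: "real mat" where
  "tail_mat_t = Matrix.mat nv ne (\<lambda>(j, i). of_bool (tail G (nth_arc i) = nth_vert j))"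

definition rev_mat :: "real mat" where
  "rev_mat = Matrix.mat ne ne (\<lambda>(i, k). of_bool (nth_arc k = arev (nth_arc i)))"

definition nb_mat :: "real mat" where
  "nb_mat = Matrix.mat ne ne (\<lambda>(i, k). of_bool (nb_step (nth_arc i) (nth_arc k)))"

text \<open>The head of an arc is the tail of its reverse, so the reverse is always among the
  successors; subtracting \<open>rev_mat\<close> removes exactly this entry.\<close>

lemma nb_mat_eq: "nb_mat = head_mat * tail_mat_t - rev_mat"
proof -
  have "(\<Sum>k<nv. of_bool (head G (nth_arc i) = nth_vert k) * of_bool (tail G (nth_arc j) = nth_vert k)) =
      (of_bool (head G (nth_arc i) = tail G (nth_arc j)) :: real)" if "i < ne" for i j
  proof -
    have "head G (nth_arc i) \<in> verts G" using arc_in[OF that] by simp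
    then show ?thesis
      unfolding sum_vert[of "\<lambda>v. of_bool (head G (nth_arc i) = v) * of_bool (tail G (nth_arc j) = v) :: real"]
      by (simp add: of_bool_def if_distrib[of "\<lambda>x. x * _"] cong: if_cong)
  qed
  then show ?thesis
    unfolding nb_mat_def head_mat_def tail_mat_t_def rev_mat_def mat_mult_mat
    by (intro eq_matI) (auto simp: nb_step_def arc_in)
qed

lemma adj_matrix_eq: "tail_mat_t * head_mat = adj_matrix G"
proof -
  have "(\<Sum>k<ne. of_bool (tail G (nth_arc k) = u) * of_bool (head G (nth_arc k) = v)) =
      real (card {e \<in> arcs G. tail G e = u \<and> head G e = v})" for u v
    unfolding sum_arc[of "\<lambda>e. of_bool (tail G e = u) * of_bool (head G e = v) :: real"]
    by (simp add: Int_def conj_assoc)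
  then show ?thesis
    unfolding tail_mat_t_def head_mat_def mat_mult_mat adj_matrix_def by (intro eq_matI) auto
qed

lemma tail_mat_t_tail_mat:
  assumes "regular_digraph d G"
  shows "tail_mat_t * tail_mat = real d \<cdot>\<^sub>m 1\<^sub>m nv"
proof -
  have "(\<Sum>k<ne. of_bool (tail G (nth_arc k) = u) * of_bool (tail G (nth_arc k) = v)) =
      (if u = v then real d else 0)" if "u \<in> verts G" for u v
  proof -
    have "real d = real (card {e \<in> arcs G. tail G e = u})"
      using assms that by (auto simp: regular_digraph_def out_degree_def out_arcs_def)
    then show ?thesis
      unfolding sum_arc[of "\<lambda>e. of_bool (tail G e = u) * of_bool (tail G e = v) :: real"]
      by (auto simp: Int_def)
  qed
  then show ?thesis
    unfolding tail_mat_t_def tail_mat_def mat_mult_mat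
    by (intro eq_matI) (auto simp: vert_in vert_eq_iff)
qed

lemma card_arcs_regular:
  assumes "regular_digraph d G"
  shows "ne = d * nv"
proof -
  have "arcs G = (\<Union>v\<in>verts G. out_arcs G v)" by (auto simp: out_arcs_def)
  also have "card \<dots> = (\<Sum>v\<in>verts G. card (out_arcs G v))"
    by (rule card_UN_disjoint) (auto simp: out_arcs_def)
  finally have "ne = (\<Sum>v\<in>verts G. card (out_arcs G v))" .
  then show ?thesis
    using assms by (simp add: regular_digraph_def out_degree_def)
qed

text \<open>\<open>rev_mat\<close> is the permutation matrix of \<open>arev\<close> and permutes
  rows from the left; this covers its products with \<open>head_mat\<close>, \<open>tail_mat\<close>
  and itself.\<close>

lemma rev_mat_mult:
  "rev_mat * Matrix.mat ne c (\<lambda>(i, j). f (nth_arc i) j) = Matrix.mat ne c (\<lambda>(i, j). f (arev (nth_arc i)) j)"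
proof -
  have "(\<Sum>k<ne. of_bool (nth_arc k = arev (nth_arc i)) * f (nth_arc k) j) = f (arev (nth_arc i)) j" if "i < ne" for i j
    unfolding sum_arc[of "\<lambda>e. of_bool (e = arev (nth_arc i)) * f e j"]
    using arc_in[OF that] by (simp add: of_bool_def if_distrib[of "\<lambda>x. x * _"] cong: if_cong)
  then show ?thesis
    unfolding rev_mat_def mat_mult_mat by (intro eq_matI) auto
qed

lemma rev_mat_head_mat: "rev_mat * head_mat = tail_mat"
  unfolding head_mat_def tail_mat_def rev_mat_mult[of nv "\<lambda>e j. of_bool (head G e = nth_vert j)"]
  by (intro eq_matI) (auto simp: arc_in)

lemma rev_mat_tail_mat: "rev_mat * tail_mat = head_mat"
  unfolding head_mat_def tail_mat_def rev_mat_mult[of nv "\<lambda>e j. of_bool (tail G e = nth_vert j)"]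
  by (intro eq_matI) (auto simp: arc_in)

lemma rev_mat_rev_mat: "rev_mat * rev_mat = 1\<^sub>m ne"
proof -
  have "rev_mat * rev_mat = rev_mat * Matrix.mat ne ne (\<lambda>(i, k). of_bool (nth_arc k = arev (nth_arc i)))"
    by (simp add: rev_mat_def)
  also have "\<dots> = 1\<^sub>m ne"
    unfolding rev_mat_mult[of ne "\<lambda>e k. of_bool (nth_arc k = arev e)"]
    by (intro eq_matI) (auto simp: arc_eq_iff)
  finally show ?thesis .
qed

lemma mat_trace_rev_mat: "mat_trace rev_mat = 0"
  unfolding mat_trace_def rev_mat_def using arev_neq[OF arc_in] by (auto intro!: sum.neutral dest: sym)

lemma nb_mat_pow:
  "nb_mat ^\<^sub>m r = Matrix.mat ne ne (\<lambda>(i, k). real (card (chains nb_step (arcs G) r (nth_arc i) (nth_arc k))))"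
proof (induction r)
  case 0
  show ?case by (intro eq_matI) (auto simp: nb_mat_def chains_0 arc_eq_iff)
next
  case (Suc r)
  have step: "(\<Sum>k<ne. real (card (chains nb_step (arcs G) r e (nth_arc k))) * of_bool (nb_step (nth_arc k) f)) =
     real (card (chains nb_step (arcs G) (Suc r) e f))" for e f
    unfolding sum_arc[of "\<lambda>g. real (card (chains nb_step (arcs G) r e g)) * of_bool (nb_step g f) :: real"]
    by (simp add: card_chains_Suc)
  show ?case
    unfolding pow_mat.simps Suc by (simp only: nb_mat_def mat_mult_mat prod.case step)
qed

lemma circuit_count_trace:
  assumes "r > 0"
  shows "real (circuit_count G arev r) = mat_trace (nb_mat ^\<^sub>m r)"
  unfolding circuit_count_eq[OF assms] mat_trace_def nb_mat_pow
  using sum_arc[of "\<lambda>e. real (card (chains nb_step (arcs G) r e e))"] by simp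

lemma adj_matrix_symmetric: "transpose_mat (adj_matrix G) = adj_matrix G"
proof -
  have "card {e \<in> arcs G. tail G e = u \<and> head G e = v} = card {e \<in> arcs G. tail G e = v \<and> head G e = u}" for u v
    by (rule bij_betw_same_card[OF bij_betw_byWitness[where f = arev and f' = arev]]) auto
  then show ?thesis
    unfolding adj_matrix_def by (intro eq_matI) auto
qed

text \<open>One list \<open>es\<close> serves as the roots of the characteristic polynomial and as
  the diagonal of the Schur form, so the spectral measure and the trace formula see the same
  multiplicities.\<close>

lemma circuit_count_spectrum:
  assumes reg: "regular_digraph (q + 1) G"
  obtains es where "adj_eigenvalues G = mset es" "length es = nv"
    "\<And>r. r > 0 \<Longrightarrow> real (circuit_count G arev r) =
       (\<Sum>x\<leftarrow>es. dickson (real q) r x) + (real q - 1) * real nv / 2 * (1 + (-1) ^ r)"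
proof -
  have A: "adj_matrix G \<in> carrier_mat nv nv" by (simp add: adj_matrix_def)
  obtain es where es: "char_poly (adj_matrix G) = (\<Prod>e\<leftarrow>es. [:- e, 1:])" "length es = nv"
    using real_symmetric_char_poly_splits[OF A adj_matrix_symmetric] by blast
  obtain T P Q where TPQ: "schur_decomposition (adj_matrix G) es = (T, P, Q)"
    by (cases "schur_decomposition (adj_matrix G) es")
  interpret hashimoto "adj_matrix G" P Q T nv es ne "real q" head_mat tail_mat tail_mat_t rev_mat nb_mat
  proof
    show "similar_mat_wit (adj_matrix G) T P Q" "upper_triangular T" "diag_mat T = es"
      using schur_decomposition[OF A es(1) TPQ] by auto
    show "tail_mat_t * tail_mat = (real q + 1) \<cdot>\<^sub>m 1\<^sub>m nv"
      using tail_mat_t_tail_mat[OF reg] by (simp add: add.commute)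
    show "real ne = (real q + 1) * real nv"
      using card_arcs_regular[OF reg] by (simp add: algebra_simps)
  qed (auto simp: A adj_matrix_eq rev_mat_head_mat rev_mat_tail_mat rev_mat_rev_mat mat_trace_rev_mat
        nb_mat_eq, auto simp: head_mat_def tail_mat_def tail_mat_t_def rev_mat_def)
  show ?thesis
  proof (rule that[of es])
    show "adj_eigenvalues G = mset es"
      unfolding adj_eigenvalues_def es(1) by (rule proots_prod_list_linear)
    show "length es = nv" by fact
    show "real (circuit_count G arev r) =
       (\<Sum>x\<leftarrow>es. dickson (real q) r x) + (real q - 1) * real nv / 2 * (1 + (-1) ^ r)" if "r > 0" for r
      unfolding circuit_count_trace[OF that] by (rule trace_Bpow)
  qed
qed

end

section \<open>Comparison of the Fourier transforms\<close>

text \<open>Grouping positions of the list by their value turns weights at distinct eigenvalues into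
  a sum over positions, the form in which the trace formula is given.\<close>

lemma fourier_spectral_measure:
  assumes "adj_eigenvalues G = mset es"
  shows "fourier_transform (spectral_measure q G) p =
    (\<Sum>i<length es. exp (\<i> * p * of_real (es ! i / sqrt (real q)))) / of_nat (card (verts G))"
proof -
  let ?n = "real (card (verts G))" and ?E = "\<lambda>x. exp (\<i> * p * of_real (x / sqrt (real q)))"
  have "fourier_transform (spectral_measure q G) p =
      (\<Sum>x\<in>set es. (real (count (mset es) x) / ?n) *\<^sub>R ?E x)"
    unfolding fourier_transform_def spectral_measure_def assms
    by (subst integral_distr)
       (simp_all add: measurable_point_measure_eq1 lebesgue_integral_point_measure_finite)
  also have "\<dots> = (\<Sum>x\<in>set es. of_nat (count (mset es) x) * ?E x) / of_nat (card (verts G))"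
    by (simp add: scaleR_conv_of_real sum_divide_distrib)
  also have "(\<Sum>x\<in>set es. of_nat (count (mset es) x) * ?E x) =
      (\<Sum>x\<in>(!) es ` {..<length es}. \<Sum>i\<in>{i\<in>{..<length es}. es ! i = x}. ?E (es ! i))"
  proof (rule sum.cong)
    show "set es = (!) es ` {..<length es}" by (auto simp: set_conv_nth)
    fix x
    have "count (mset es) x = card {i. i < length es \<and> es ! i = x}"
      by (auto simp: count_mset count_list_eq_length_filter length_filter_conv_card intro!: arg_cong[where f = card])
    then show "of_nat (count (mset es) x) * ?E x = (\<Sum>i\<in>{i\<in>{..<length es}. es ! i = x}. ?E (es ! i))"
      by simp
  qed
  also have "\<dots> = (\<Sum>i<length es. ?E (es ! i))"
    by (rule sum.image_gen[symmetric]) simp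
  finally show ?thesis .
qed

lemma dickson_normalized:
  assumes "q > 0"
  shows "real q powr (- real r / 2) * dickson (real q) r x = dickson 1 r (x / sqrt (real q))"
proof -
  have "dickson ((sqrt (real q))\<^sup>2 * 1) r (sqrt (real q) * (x / sqrt (real q))) =
      sqrt (real q) ^ r * dickson 1 r (x / sqrt (real q))"
    by (rule dickson_scale)
  then have "dickson (real q) r x = sqrt (real q) ^ r * dickson 1 r (x / sqrt (real q))"
    using assms by simp
  moreover have "sqrt (real q) ^ r = real q powr (real r / 2)"
    using assms by (simp add: powr_half_sqrt[symmetric] powr_power)
  moreover have "real q powr (- real r / 2) * real q powr (real r / 2) = 1"
    using assms by (simp add: powr_add[symmetric])
  ultimately show ?thesis by (simp add: mult.assoc[symmetric])
qed

context finite_bidirected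
begin

text \<open>\<open>p\<close> enters the bound through \<open>K\<close> alone, as the Weierstrass
  test requires; q^(-r/2) and 1/|V| are estimated by 1.\<close>

lemma norm_circuit_term_le:
  assumes "q > 0" "verts G \<noteq> {}" "norm p \<le> K"
  shows "norm (circuit_term q G arev r p) \<le> (K * real ne) ^ r / fact r * exp (K\<^sup>2)"
proof -
  have nv: "nv > 0" using assms(2) by (simp add: card_gt_0_iff)
  have K: "0 \<le> K" using order_trans[OF norm_ge_zero assms(3)] .
  have "real q powr (- real r / 2) \<le> 1"
    using assms(1) powr_mono[of "- real r / 2" 0 "real q"] by simp
  moreover have "norm (bessel_J r (2 * p)) \<le> K ^ r / fact r * exp (K\<^sup>2)"
  proof -
    have "norm (bessel_J r (2 * p)) \<le> norm p ^ r / fact r * exp ((norm p)\<^sup>2)"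
      using norm_bessel_J_le[of r "2 * p"] by simp
    also have "\<dots> \<le> K ^ r / fact r * exp (K\<^sup>2)"
      using assms(3) K
      by (intro mult_mono divide_right_mono power_mono) (auto intro: power_mono)
    finally show ?thesis .
  qed
  moreover have "real (circuit_count G arev r) / real nv \<le> real ne ^ r"
  proof -
    have "real (circuit_count G arev r) / real nv \<le> real (circuit_count G arev r) / 1"
      using nv by (intro divide_left_mono) auto
    also have "\<dots> \<le> real ne ^ r"
      using circuit_count_le[of r] by (simp flip: of_nat_power)
    finally show ?thesis .
  qed
  ultimately have "real q powr (- real r / 2) * norm (bessel_J r (2 * p)) * (real (circuit_count G arev r) / real nv)
      \<le> 1 * (K ^ r / fact r * exp (K\<^sup>2)) * real ne ^ r"
    by (intro mult_mono) (use K in auto)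
  then show ?thesis
    by (simp add: circuit_term_def norm_mult norm_power norm_divide power_mult_distrib mult_ac)
qed

lemma summable_circuit_bound: "summable (\<lambda>r. (K * real ne) ^ Suc r / fact (Suc r) * exp (K\<^sup>2))"
  by (subst summable_Suc_iff) (intro summable_mult2 summable_exp_real)

text \<open>The order 0 terms cancel: \<open>bessel_J 0\<close> appears with coefficient 1 on both
  sides, the total mass of either measure.\<close>

lemma circuit_term_sums:
  assumes q: "q > 0" and ne: "verts G \<noteq> {}" and reg: "regular_digraph (q + 1) G"
  shows "(\<lambda>r. circuit_term q G arev (Suc r) p) sums
    (fourier_transform (spectral_measure q G) p - fourier_transform (kesten_mckay q) p)"
proof -
  have nv: "nv > 0" using ne by (simp add: card_gt_0_iff)
  obtain es where es: "adj_eigenvalues G = mset es" "length es = nv"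
    and count: "\<And>r. r > 0 \<Longrightarrow> real (circuit_count G arev r) =
       (\<Sum>x\<leftarrow>es. dickson (real q) r x) + (real q - 1) * real nv / 2 * (1 + (-1) ^ r)"
    using circuit_count_spectrum[OF reg] by metis
  define y where "y i = es ! i / sqrt (real q)" for i
  let ?J = "\<lambda>r. \<i> ^ Suc r * bessel_J (Suc r) (2 * p)"
  let ?k = "\<lambda>r. - (real q - 1) / 2 * real q powr (- real (Suc r) / 2) * (1 + (-1) ^ Suc r)"
  have "(\<lambda>r. (\<Sum>i<nv. ?J r * dickson 1 (Suc r) (of_real (y i))) / of_nat nv) sums
      ((\<Sum>i<nv. exp (\<i> * p * of_real (y i)) - bessel_J 0 (2 * p)) / of_nat nv)"
    by (intro sums_divide sums_sum Jacobi_Anger)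
  also have "(\<Sum>i<nv. exp (\<i> * p * of_real (y i)) - bessel_J 0 (2 * p)) / of_nat nv =
      fourier_transform (spectral_measure q G) p - bessel_J 0 (2 * p)"
    unfolding fourier_spectral_measure[OF es(1)] y_def es(2) using ne
    by (simp add: sum_subtractf diff_divide_distrib)
  finally have 1: "(\<lambda>r. (\<Sum>i<nv. ?J r * dickson 1 (Suc r) (of_real (y i))) / of_nat nv) sums
      (fourier_transform (spectral_measure q G) p - bessel_J 0 (2 * p))" .
  have "circuit_term q G arev (Suc r) p =
      (\<Sum>i<nv. ?J r * dickson 1 (Suc r) (of_real (y i))) / of_nat nv - ?J r * of_real (?k r)" for r
  proof -
    let ?w = "real q powr (- real (Suc r) / 2)"
    have "?w * (real (circuit_count G arev (Suc r)) / real nv) =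
        (\<Sum>x\<leftarrow>es. ?w * dickson (real q) (Suc r) x) / real nv - ?k r"
    proof -
      \<comment> \<open>Division by |V| turns the correction of the trace formula into the negative
        of \<open>?k r\<close>, the coefficient of the Kesten-McKay series.\<close>
      have "w * ((D + a * n / 2 * s) / n) = w * D / n - (- a / 2 * w * s)" if "n > 0" for w D a n s :: real
        using that by (simp add: field_simps)
      then show ?thesis
        using nv by (simp only: count zero_less_Suc sum_list_const_mult of_nat_0_less_iff)
    qed
    also have "(\<Sum>x\<leftarrow>es. ?w * dickson (real q) (Suc r) x) = (\<Sum>i<nv. dickson 1 (Suc r) (y i))"
      unfolding dickson_normalized[OF q] y_def
      by (simp add: sum_list_sum_nth es(2) atLeast0LessThan del: dickson.simps)
    finally have w: "?w * (real (circuit_count G arev (Suc r)) / real nv) =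
        (\<Sum>i<nv. dickson 1 (Suc r) (y i)) / real nv - ?k r" .
    have "circuit_term q G arev (Suc r) p = ?J r * of_real (?w * (real (circuit_count G arev (Suc r)) / real nv))"
      by (simp only: circuit_term_def of_real_mult of_real_divide of_real_of_nat_eq mult_ac)
    then have "circuit_term q G arev (Suc r) p =
        ?J r * of_real ((\<Sum>i<nv. dickson 1 (Suc r) (y i)) / real nv - ?k r)"
      unfolding w .
    then show ?thesis
      by (simp only: of_real_diff of_real_divide of_real_sum of_real_dickson of_real_1 of_real_of_nat_eq
          right_diff_distrib times_divide_eq_right sum_distrib_left)
  qed
  moreover have "(\<lambda>r. (\<Sum>i<nv. ?J r * dickson 1 (Suc r) (of_real (y i))) / of_nat nv - ?J r * of_real (?k r)) sums
      ((fourier_transform (spectral_measure q G) p - bessel_J 0 (2 * p)) -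
       (fourier_transform (kesten_mckay q) p - bessel_J 0 (2 * p)))"
    by (rule sums_diff[OF 1 fourier_kesten_mckay_sums[OF q]])
  ultimately show ?thesis by (simp del: power_Suc of_nat_Suc dickson.simps)
qed

end

theorem theorem6p2:
  fixes G :: "('a, 'b) pre_digraph" and arev :: "'b \<Rightarrow> 'b" and q :: nat
  assumes "q > 0"
    and "fin_digraph G" and "bidirected_digraph G arev"
    and "verts G \<noteq> {}"
    and "regular_digraph (q + 1) G"
  shows "(\<forall>p :: complex. fourier_transform (spectral_measure q G) p =
            fourier_transform (kesten_mckay q) p + (\<Sum>r. circuit_term q G arev (Suc r) p)) \<and>
         (\<forall>K :: complex set. compact K \<longrightarrow>
            (\<forall>p \<in> K. summable (\<lambda>r. norm (circuit_term q G arev (Suc r) p))) \<and>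
            uniform_limit K (\<lambda>N p. \<Sum>r<N. circuit_term q G arev (Suc r) p)
              (\<lambda>p. \<Sum>r. circuit_term q G arev (Suc r) p) sequentially)"
proof -
  interpret finite_bidirected G arev
    using assms(2,3) by (simp add: finite_bidirected_def)
  have eq: "fourier_transform (spectral_measure q G) p =
      fourier_transform (kesten_mckay q) p + (\<Sum>r. circuit_term q G arev (Suc r) p)" for p
    using circuit_term_sums[OF assms(1,4,5), of p] by (simp add: sums_iff)
  have summ: "summable (\<lambda>r. norm (circuit_term q G arev (Suc r) p))" for p
    by (rule summable_comparison_test'[OF summable_circuit_bound[of "norm p"]])
       (simp only: real_norm_def abs_norm_cancel norm_circuit_term_le[OF assms(1,4) order_refl])
  have unif: "uniform_limit K (\<lambda>N p. \<Sum>r<N. circuit_term q G arev (Suc r) p)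
      (\<lambda>p. \<Sum>r. circuit_term q G arev (Suc r) p) sequentially" if "compact K" for K
  proof -
    obtain C where C: "\<And>p. p \<in> K \<Longrightarrow> norm p \<le> C"
      using compact_imp_bounded[OF \<open>compact K\<close>] by (auto simp: bounded_iff)
    show ?thesis
      by (rule Weierstrass_m_test[OF norm_circuit_term_le[OF assms(1,4) C] summable_circuit_bound])
  qed
  show ?thesis using eq summ unif by blast
qed

end
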